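(* Let $U,V\subset\mathbb R^n$ be open bounded and let $c\in C^4(\overline U\times\overline V)$ satisfy (B1), (B2) and (A3w). Fix $\tilde y\in\overline V$. If $u$ is $c$-convex on $\overline U$, then $\tilde u(q):=u(x(q))+c(x(q),\tilde y)$ has convex level sets as a function of $q\in\overline U_{\tilde y}$. If in addition $c$ satisfies (B3), then $\tilde u$ is convex on $\overline U_{\tilde y}$. In either case $\tilde u$ attains its minimum at $q_0$ whenever $\tilde y\in\partial^cu(x(q_0))$. Furthermore $\tilde u$ is $\tilde c$-convex with respect to the modified cost $\tilde c(q,y):=c(x(q),y)-c(x(q),\tilde y)$ on $\overline U_{\tilde y}\times\overline V$, and $\partial^{\tilde c}\tilde u(q)=\partial^cu(x(q))$ for all $q\in\overline U_{\tilde y}$.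
   Context: (B1): for every $\tilde x\in\overline U,\tilde y\in\overline V$ the maps $x\in\overline U\mapsto-D_yc(x,\tilde y)$ and $y\in\overline V\mapsto -D_xc(\tilde x,y)$ are diffeomorphisms onto their ranges. (B2): $U_{\tilde y}:=-D_yc(U,\tilde y)$ and $V_{\tilde x}:=-D_xc(\tilde x,V)$ are convex for all $\tilde x,\tilde y$. (B3): for all curves $x(\cdot),y(\cdot)$ such that $t\in[-1,1]\mapsto(D_yc(x(t),y(0)),D_xc(x(0),y(t)))$ is an affinely parametrized line segment, $-\partial_s^2\partial_t^2c(x(s),y(t))|_{s=t=0}\ge0$. (A3w): the same inequality, but required only for those curves that additionally satisfy $\partial_s\partial_tc(x(s),y(t))|_{s=t=0}=0$. Cost-exponential coordinates: $\overline U_{\tilde y}:=-D_yc(\overline U,\tilde y)$ and $x:\overline U_{\tilde y}\to\overline U$ is the inverse of $x\mapsto-D_yc(x,\tilde y)$, i.e. $q=-D_yc(x(q),\tilde y)$. For a cost $k$ on $A\times\overline V$ and $w:A\to\mathbb R$: $w^{k^*}(y):=\sup_{a\in A}(-k(a,y)-w(a))$, $v^k(a):=\sup_{y\in\overline V}(-k(a,y)-v(y))$, $w$ is $k$-convex if $w=(w^{k^*})^k$, and $\partial^kw(a):=\{y\in\overline V: w(a)+w^{k^*}(y)+k(a,y)=0\}$. This is applied with $(A,k)=(\overline U,c)$ and $(A,k)=(\overline U_{\tilde y},\tilde c)$. *)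

theory Defs
  imports "HOL-Analysis.Analysis"
begin

fun Ck :: "nat \<Rightarrow> ('v::real_normed_vector \<Rightarrow> real) \<Rightarrow> 'v set \<Rightarrow> bool" where
  "Ck 0 f S = continuous_on S f"
| "Ck (Suc k) f S = ((\<forall>z\<in>S. f differentiable (at z)) \<and>
                      (\<forall>v. Ck k (\<lambda>z. frechet_derivative f (at z) v) S))"

definition C4_on_closure :: "('a::euclidean_space \<Rightarrow> 'a \<Rightarrow> real) \<Rightarrow> 'a set \<Rightarrow> 'a set \<Rightarrow> bool" where
  "C4_on_closure c U V \<longleftrightarrow>
     (\<exists>W. open W \<and> closure U \<times> closure V \<subseteq> W \<and> Ck 4 (\<lambda>z. c (fst z) (snd z)) W)"

definition grad :: "('a::euclidean_space \<Rightarrow> real) \<Rightarrow> 'a \<Rightarrow> 'a" where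
  "grad f x = (\<Sum>b\<in>Basis. frechet_derivative f (at x) b *\<^sub>R b)"

definition Dx :: "('a::euclidean_space \<Rightarrow> 'a \<Rightarrow> real) \<Rightarrow> 'a \<Rightarrow> 'a \<Rightarrow> 'a" where
  "Dx c x y = grad (\<lambda>x'. c x' y) x"

definition Dy :: "('a::euclidean_space \<Rightarrow> 'a \<Rightarrow> real) \<Rightarrow> 'a \<Rightarrow> 'a \<Rightarrow> 'a" where
  "Dy c x y = grad (\<lambda>y'. c x y') y"

definition diffeo_onto_range :: "('a::euclidean_space \<Rightarrow> 'a) \<Rightarrow> 'a set \<Rightarrow> bool" where
  "diffeo_onto_range f S \<longleftrightarrow>
     inj_on f S \<and>
     (\<forall>x\<in>S. \<exists>f'. (f has_derivative f') (at x) \<and> bij f') \<and>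
     (\<forall>p\<in>f ` S. \<exists>g'. (inv_into S f has_derivative g') (at p within f ` S))"

definition B1 :: "'a::euclidean_space set \<Rightarrow> 'a set \<Rightarrow> ('a \<Rightarrow> 'a \<Rightarrow> real) \<Rightarrow> bool" where
  "B1 U V c \<longleftrightarrow>
     (\<forall>yt\<in>closure V. diffeo_onto_range (\<lambda>x. - Dy c x yt) (closure U)) \<and>
     (\<forall>xt\<in>closure U. diffeo_onto_range (\<lambda>y. - Dx c xt y) (closure V))"

definition B2 :: "'a::euclidean_space set \<Rightarrow> 'a set \<Rightarrow> ('a \<Rightarrow> 'a \<Rightarrow> real) \<Rightarrow> bool" where
  "B2 U V c \<longleftrightarrow>
     (\<forall>yt\<in>closure V. convex ((\<lambda>x. - Dy c x yt) ` U)) \<and>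
     (\<forall>xt\<in>closure U. convex ((\<lambda>y. - Dx c xt y) ` V))"

definition d1 :: "(real \<Rightarrow> real \<Rightarrow> real) \<Rightarrow> real \<Rightarrow> real \<Rightarrow> real" where
  "d1 F s t = deriv (\<lambda>s'. F s' t) s"

definition d2 :: "(real \<Rightarrow> real \<Rightarrow> real) \<Rightarrow> real \<Rightarrow> real \<Rightarrow> real" where
  "d2 F s t = deriv (\<lambda>t'. F s t') t"

definition seg_curves :: "'a::euclidean_space set \<Rightarrow> 'a set \<Rightarrow> ('a \<Rightarrow> 'a \<Rightarrow> real)
     \<Rightarrow> (real \<Rightarrow> 'a) \<Rightarrow> (real \<Rightarrow> 'a) \<Rightarrow> bool" where
  "seg_curves U V c x y \<longleftrightarrow>
     (\<forall>t\<in>{-1..1}. x t \<in> closure U \<and> y t \<in> closure V) \<and>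
     (\<exists>a b. \<forall>t\<in>{-1..1}. (Dy c (x t) (y 0), Dx c (x 0) (y t)) = a + t *\<^sub>R b)"

definition B3 :: "'a::euclidean_space set \<Rightarrow> 'a set \<Rightarrow> ('a \<Rightarrow> 'a \<Rightarrow> real) \<Rightarrow> bool" where
  "B3 U V c \<longleftrightarrow>
     (\<forall>x y. seg_curves U V c x y \<longrightarrow>
        - d1 (d1 (d2 (d2 (\<lambda>s t. c (x s) (y t))))) 0 0 \<ge> 0)"

definition A3w :: "'a::euclidean_space set \<Rightarrow> 'a set \<Rightarrow> ('a \<Rightarrow> 'a \<Rightarrow> real) \<Rightarrow> bool" where
  "A3w U V c \<longleftrightarrow>
     (\<forall>x y. seg_curves U V c x y \<longrightarrow> d1 (d2 (\<lambda>s t. c (x s) (y t))) 0 0 = 0 \<longrightarrow>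
        - d1 (d1 (d2 (d2 (\<lambda>s t. c (x s) (y t))))) 0 0 \<ge> 0)"

definition cexp_dom :: "'a::euclidean_space set \<Rightarrow> ('a \<Rightarrow> 'a \<Rightarrow> real) \<Rightarrow> 'a \<Rightarrow> 'a set" where
  "cexp_dom U c yt = (\<lambda>x. - Dy c x yt) ` closure U"

definition cexp_x :: "'a::euclidean_space set \<Rightarrow> ('a \<Rightarrow> 'a \<Rightarrow> real) \<Rightarrow> 'a \<Rightarrow> 'a \<Rightarrow> 'a" where
  "cexp_x U c yt = inv_into (closure U) (\<lambda>x. - Dy c x yt)"

definition kstar :: "'a set \<Rightarrow> ('a \<Rightarrow> 'b \<Rightarrow> real) \<Rightarrow> ('a \<Rightarrow> real) \<Rightarrow> 'b \<Rightarrow> ereal" where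
  "kstar A k w y = (SUP a\<in>A. ereal (- k a y - w a))"

definition ktrans :: "'b set \<Rightarrow> ('a \<Rightarrow> 'b \<Rightarrow> real) \<Rightarrow> ('b \<Rightarrow> ereal) \<Rightarrow> 'a \<Rightarrow> ereal" where
  "ktrans Y k v a = (SUP y\<in>Y. ereal (- k a y) - v y)"

definition kconvex :: "'a set \<Rightarrow> 'b set \<Rightarrow> ('a \<Rightarrow> 'b \<Rightarrow> real) \<Rightarrow> ('a \<Rightarrow> real) \<Rightarrow> bool" where
  "kconvex A Y k w \<longleftrightarrow> (\<forall>a\<in>A. ereal (w a) = ktrans Y k (kstar A k w) a)"

definition ksubdiff :: "'a set \<Rightarrow> 'b set \<Rightarrow> ('a \<Rightarrow> 'b \<Rightarrow> real) \<Rightarrow> ('a \<Rightarrow> real) \<Rightarrow> 'a \<Rightarrow> 'b set" where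
  "ksubdiff A Y k w a = {y\<in>Y. ereal (w a) + kstar A k w y + ereal (k a y) = 0}"

end

theory Submission
  imports Defs
begin

text \<open>
By definition of c-convexity, the transformed potential is a supremum of functions
\<open>q \<mapsto> c(x(q), yt) - c(x(q), y)\<close> plus constants, so it suffices to treat each of them along a
segment \<open>q(s)\<close>; call the result \<open>f\<close>. Fix \<open>s\<close> and join \<open>yt\<close> to \<open>y\<close> by the curve \<open>y(t)\<close> for which
\<open>D\<^sub>xc(x(s), y(t))\<close> is affine in \<open>t\<close>. The second \<open>s\<close>-derivative of \<open>-c(x(s), y(t))\<close> at the fixed \<open>s\<close> is a
convex function of \<open>t\<close> under (B3), and under (A3w) when \<open>f'(s) = 0\<close>; its \<open>t\<close>-derivative vanishes at \<open>t = 0\<close>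
because \<open>D\<^sub>yc(x(s), yt)\<close> is affine in \<open>s\<close>. Comparing \<open>t = 0\<close> with \<open>t = 1\<close> gives \<open>f''(s) \<ge> 0\<close>.

Under (A3w) this is known only at critical points, which alone does not give quasiconvexity
(consider \<open>-s^4\<close>). Near a critical point with \<open>f' > 0\<close> one can move \<open>y\<close> by \<open>O(f'(s))\<close> so that \<open>s\<close> becomes
critical for the perturbed function; hence \<open>f'' \<ge> -L f'\<close> there, and a Gronwall argument shows
that \<open>f'\<close> cannot return to zero after having been positive.
\<close>

section \<open>Iterated directional derivatives\<close>

text \<open>The curvature conditions test curves on the two-sided interval \<open>{-1..1}\<close>,
  so they can be exploited only around interior points, while \<open>yt\<close> and the claim live
  on closures. Hence the curve from \<open>yt\<close> to \<open>y\<close> is made to lie in the open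
  set \<open>V\<close> for every positive t (by convexity), only a first-order condition is used at
  t = 0, and the remaining boundary points are reached by limits. A second obstacle: the condition
  at (x(s), y(t)) speaks of x-curves that are segments for y(t), whereas the x-curve at hand is a
  segment for \<open>yt\<close>. The two may share a velocity but not an acceleration. The
  difference is harmless: because D_x c(x(s), y(t)) is affine in t with s fixed, every term linear
  in the x-acceleration vanishes. As for regularity, (B1) provides only a first derivative of the
  inverse, relative to the range; the second derivative of a segment is recovered from the twice
  differentiated equation that defines it.\<close>

definition dd :: "'v::real_normed_vector \<Rightarrow> ('v \<Rightarrow> real) \<Rightarrow> 'v \<Rightarrow> real" where
  "dd v f = (\<lambda>z. frechet_derivative f (at z) v)"

lemma Ck_Suc_dd:
  "Ck (Suc k) f S \<longleftrightarrow> (\<forall>z\<in>S. f differentiable (at z)) \<and> (\<forall>v. Ck k (dd v f) S)"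
  by (simp add: dd_def)

declare Ck.simps(2) [simp del]

lemma Ck_dd: "Ck (Suc k) f S \<Longrightarrow> Ck k (dd v f) S"
  by (simp add: Ck_Suc_dd)

lemma Ck_continuous_on: "Ck k f S \<Longrightarrow> continuous_on S f"
proof (cases k)
  case (Suc n)
  then show "Ck k f S \<Longrightarrow> ?thesis"
    by (simp add: Ck_Suc_dd continuous_at_imp_continuous_on differentiable_imp_continuous_within)
qed simp

lemma Ck_mono: "Ck k f S \<Longrightarrow> j \<le> k \<Longrightarrow> Ck j f S"
proof (induction k arbitrary: j f)
  case (Suc k)
  show ?case
  proof (cases j)
    case 0
    then show ?thesis using Ck_continuous_on[OF Suc.prems(1)] by simp
  next
    case (Suc i)
    then show ?thesis using Suc.prems Suc.IH by (auto simp: Ck_Suc_dd)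
  qed
qed simp

lemma dd_cong_open:
  assumes "open S" "z \<in> S" "\<And>x. x \<in> S \<Longrightarrow> f x = g x" "f differentiable (at z)"
  shows "dd v f z = dd v g z" "g differentiable (at z)"
proof -
  have "(f has_derivative frechet_derivative f (at z)) (at z)"
    using assms(4) by (simp add: frechet_derivative_works)
  then have g: "(g has_derivative frechet_derivative f (at z)) (at z)"
    using assms(1-3) by (rule has_derivative_transform_within_open)
  show "dd v f z = dd v g z" using frechet_derivative_at[OF g] by (simp add: dd_def)
  show "g differentiable (at z)" using g by (auto simp: differentiable_def)
qed

lemma Ck_cong_open:
  assumes "open S" "\<And>x. x \<in> S \<Longrightarrow> f x = g x" "Ck k f S"
  shows "Ck k g S"
  using assms(2,3)
proof (induction k arbitrary: f g)
  case 0
  then show ?case using continuous_on_cong by force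
next
  case (Suc k)
  have "Ck k (dd v g) S" for v
    using Suc.IH[of "dd v f" "dd v g"] dd_cong_open(1)[OF assms(1)] Suc.prems
    by (auto simp: Ck_Suc_dd)
  moreover have "g differentiable (at z)" if "z \<in> S" for z
    using dd_cong_open(2)[OF assms(1) that] Suc.prems that by (auto simp: Ck_Suc_dd)
  ultimately show ?case by (simp add: Ck_Suc_dd)
qed

lemma dd_eqI: "(f has_derivative f') (at z) \<Longrightarrow> dd v f z = f' v"
  using frechet_derivative_at[of f f' z] by (simp add: dd_def)

text \<open>Serves to freeze one variable of the cost, with \<open>L x = (x, 0)\<close> or
  \<open>L y = (0, y)\<close>. The chain rule turns \<open>dd v\<close> of the composite into
  \<open>dd (L v) f\<close> composed with the same affine map, so the induction closes.\<close>

lemma Ck_affine: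
  fixes L :: "'u::real_normed_vector \<Rightarrow> 'v::real_normed_vector"
  assumes L: "bounded_linear L" and "open S" and "Ck k f S"
  shows "Ck k (\<lambda>x. f (a + L x)) {x. a + L x \<in> S}"
  using assms(3)
proof (induction k arbitrary: f)
  case 0
  then have "continuous_on S f" by simp
  moreover have "continuous_on {x. a + L x \<in> S} (\<lambda>x. a + L x)"
    by (intro continuous_on_add continuous_on_const bounded_linear.continuous_on[OF L] continuous_on_id)
  ultimately show ?case
    unfolding Ck.simps by (rule continuous_on_compose2) auto
next
  case (Suc k)
  let ?T = "{x. a + L x \<in> S}"
  have op: "open ?T"
  proof -
    have "continuous_on UNIV (\<lambda>x. a + L x)"
      by (intro continuous_on_add continuous_on_const bounded_linear.continuous_on[OF L] continuous_on_id)
    from open_vimage[OF \<open>open S\<close> this] show ?thesis unfolding vimage_def .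
  qed
  have der: "((\<lambda>x. f (a + L x)) has_derivative (\<lambda>v. frechet_derivative f (at (a + L x)) (L v))) (at x)"
    if "x \<in> ?T" for x
  proof -
    have f: "(f has_derivative frechet_derivative f (at (a + L x))) (at (a + L x))"
      using Suc.prems that by (simp add: Ck_Suc_dd flip: frechet_derivative_works)
    have "((\<lambda>x. a + L x) has_derivative L) (at x)"
      using has_derivative_add[OF has_derivative_const bounded_linear_imp_has_derivative[OF L], of a "at x"]
      by simp
    from diff_chain_at[OF this f] show ?thesis by (simp add: o_def)
  qed
  have "Ck k (dd v (\<lambda>x. f (a + L x))) ?T" for v
  proof (rule Ck_cong_open[OF op])
    show "Ck k (\<lambda>x. dd (L v) f (a + L x)) ?T"
      using Suc by (simp add: Ck_Suc_dd)
  next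
    fix x assume "x \<in> ?T"
    from dd_eqI[OF der[OF this], of v] show "dd (L v) f (a + L x) = dd v (\<lambda>x. f (a + L x)) x"
      by (simp add: dd_def)
  qed
  then show ?case using der by (auto simp: Ck_Suc_dd differentiable_def)
qed

lemma dd_linear:
  assumes "f differentiable (at z)"
  shows "linear (\<lambda>v. dd v f z)"
  using linear_frechet_derivative[OF assms] by (simp add: dd_def)

text \<open>Velocities of curves are directions that move with a parameter; the expansion reduces
  them to finitely many fixed directions, for which continuity and derivatives are known.\<close>

lemma dd_expand:
  fixes f :: "'v::euclidean_space \<Rightarrow> real"
  assumes "f differentiable (at z)"
  shows "dd v f z = (\<Sum>b\<in>Basis. (v \<bullet> b) * dd b f z)"
proof -
  interpret linear "\<lambda>v. dd v f z" by (rule dd_linear[OF assms])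
  have "dd v f z = dd (\<Sum>b\<in>Basis. (v \<bullet> b) *\<^sub>R b) f z" by (simp add: euclidean_representation)
  also have "\<dots> = (\<Sum>b\<in>Basis. (v \<bullet> b) * dd b f z)" by (simp add: sum scale)
  finally show ?thesis .
qed

lemma dd_cmult:
  assumes "f differentiable (at z)"
  shows "dd v (\<lambda>x. c * f x) z = c * dd v f z"
  using assms by (intro dd_eqI) (auto simp: dd_def frechet_derivative_works intro!: derivative_eq_intros)

lemma has_real_derivative_curve:
  fixes f :: "'v::real_normed_vector \<Rightarrow> real"
  assumes "f differentiable (at (\<gamma> t))" "(\<gamma> has_vector_derivative v) (at t within T)"
  shows "((\<lambda>t. f (\<gamma> t)) has_real_derivative dd v f (\<gamma> t)) (at t within T)"
proof -
  have f: "(f has_derivative (\<lambda>v. dd v f (\<gamma> t))) (at (\<gamma> t))"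
    using assms(1) by (simp add: frechet_derivative_works dd_def)
  interpret linear "\<lambda>v. dd v f (\<gamma> t)" by (rule dd_linear[OF assms(1)])
  have "((\<lambda>t. f (\<gamma> t)) has_derivative (\<lambda>h. dd (h *\<^sub>R v) f (\<gamma> t))) (at t within T)"
    using has_derivative_compose[OF assms(2)[unfolded has_vector_derivative_def] f] .
  then show ?thesis
    unfolding scale has_field_derivative_def by (simp add: mult_commute_abs)
qed

lemma Ck_1D:
  assumes "Ck 1 f S"
  shows "z \<in> S \<Longrightarrow> f differentiable (at z)" "continuous_on S (dd v f)"
  using assms Ck_Suc_dd[of 0 f S] by auto

lemma Ck_2D:
  assumes "Ck 2 f S"
  shows "z \<in> S \<Longrightarrow> f differentiable (at z)" "z \<in> S \<Longrightarrow> dd v f differentiable (at z)"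
    "continuous_on S (dd v (dd w f))"
proof -
  have f: "\<forall>z\<in>S. f differentiable (at z)" "Ck 1 (dd u f) S" for u
    using assms Ck_Suc_dd[of 1 f S] by (simp_all add: numeral_2_eq_2)
  show "z \<in> S \<Longrightarrow> f differentiable (at z)" using f(1) by blast
  show "z \<in> S \<Longrightarrow> dd v f differentiable (at z)" by (rule Ck_1D(1)[OF f(2)])
  show "continuous_on S (dd v (dd w f))" by (rule Ck_1D(2)[OF f(2)])
qed

lemma has_field_derivative_transform:
  assumes "x \<in> S" "\<And>y. y \<in> S \<Longrightarrow> g y = f y" "(f has_field_derivative f') (at x within S)"
  shows "(g has_field_derivative f') (at x within S)"
  using assms has_derivative_transform[of x S g f "(*) f'"] by (simp add: has_field_derivative_def)

text \<open>Two applications of the mean value theorem: along \<open>v\<close> to the increment of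
  \<open>f\<close> in direction \<open>w\<close>, then along \<open>w\<close> to
  \<open>dd v f\<close>. The left-hand side is symmetric in \<open>v\<close> and \<open>w\<close>,
  which is what makes it useful for interchanging derivatives.\<close>

lemma second_difference:
  fixes f :: "'v::real_normed_vector \<Rightarrow> real"
  assumes C: "Ck 2 f S" and "0 < h"
    and S: "\<And>s t. 0 \<le> s \<Longrightarrow> s \<le> h \<Longrightarrow> 0 \<le> t \<Longrightarrow> t \<le> h \<Longrightarrow> z + s *\<^sub>R v + t *\<^sub>R w \<in> S"
  shows "\<exists>s t. 0 \<le> s \<and> s \<le> h \<and> 0 \<le> t \<and> t \<le> h \<and>
    f (z + h *\<^sub>R v + h *\<^sub>R w) - f (z + h *\<^sub>R v) - f (z + h *\<^sub>R w) + f z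
      = h\<^sup>2 * dd w (dd v f) (z + s *\<^sub>R v + t *\<^sub>R w)"
proof -
  have df: "f differentiable (at x)" "dd u f differentiable (at x)" if "x \<in> S" for x u
    using Ck_2D[OF C] that by auto
  define G where "G s = f (z + s *\<^sub>R v + h *\<^sub>R w) - f (z + s *\<^sub>R v + 0 *\<^sub>R w)" for s
  define G' where "G' s = dd v f (z + s *\<^sub>R v + h *\<^sub>R w) - dd v f (z + s *\<^sub>R v + 0 *\<^sub>R w)" for s
  have lin1: "((\<lambda>s. z + s *\<^sub>R v + t *\<^sub>R w) has_vector_derivative v) (at s)" for s t
    by (auto intro!: derivative_eq_intros)
  have lin2: "((\<lambda>t. z + s *\<^sub>R v + t *\<^sub>R w) has_vector_derivative w) (at t)" for s t
    by (auto intro!: derivative_eq_intros)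
  have "DERIV G s :> G' s" if "0 \<le> s" "s \<le> h" for s
    unfolding G_def G'_def
    using that \<open>0 < h\<close> by (intro DERIV_diff has_real_derivative_curve df(1) S lin1) auto
  from MVT2[OF \<open>0 < h\<close> this] obtain s where s: "0 < s" "s < h" "G h - G 0 = h * G' s" by auto
  have "DERIV (\<lambda>t. dd v f (z + s *\<^sub>R v + t *\<^sub>R w)) t :> dd w (dd v f) (z + s *\<^sub>R v + t *\<^sub>R w)"
    if "0 \<le> t" "t \<le> h" for t
    using that s by (intro has_real_derivative_curve df(2) S lin2) auto
  from MVT2[OF \<open>0 < h\<close> this] obtain t where t: "0 < t" "t < h"
    "G' s = h * dd w (dd v f) (z + s *\<^sub>R v + t *\<^sub>R w)" by (auto simp: G'_def)
  show ?thesis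
    using s t by (intro exI[of _ s] exI[of _ t]) (auto simp: G_def power2_eq_square)
qed

text \<open>Both iterated derivatives, each taken at some point of a small parallelogram, equal the
  same second difference divided by \<open>h\<^sup>2\<close>. Continuity then forbids a gap between
  their values at \<open>z\<close>.\<close>

lemma dd_commute:
  fixes f :: "'v::real_normed_vector \<Rightarrow> real"
  assumes C: "Ck 2 f S" and S: "open S" "z \<in> S"
  shows "dd w (dd v f) z = dd v (dd w f) z"
proof (rule ccontr)
  define A where "A = dd w (dd v f)"
  define B where "B = dd v (dd w f)"
  assume "\<not> ?thesis"
  then have ne: "A z \<noteq> B z" by (simp add: A_def B_def)
  define e where "e = \<bar>A z - B z\<bar> / 2"
  have "e > 0" using ne by (simp add: e_def)
  have cont: "isCont A z" "isCont B z"
    using Ck_2D(3)[OF C] S by (auto simp: A_def B_def continuous_on_eq_continuous_at)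
  from cont(1) obtain d1 where d1: "d1 > 0" "\<And>x. dist x z < d1 \<Longrightarrow> \<bar>A x - A z\<bar> < e"
    using \<open>e > 0\<close> unfolding continuous_at_eps_delta dist_real_def by blast
  from cont(2) obtain d2 where d2: "d2 > 0" "\<And>x. dist x z < d2 \<Longrightarrow> \<bar>B x - B z\<bar> < e"
    using \<open>e > 0\<close> unfolding continuous_at_eps_delta dist_real_def by blast
  obtain d3 where d3: "d3 > 0" "ball z d3 \<subseteq> S" using S openE by blast
  define d where "d = Min {d1, d2, d3}"
  have d: "d > 0" "d \<le> d1" "d \<le> d2" "d \<le> d3" using d1 d2 d3 by (auto simp: d_def)
  \<comment> \<open>Makes the whole parallelogram stay within \<open>d / 2\<close> of
    \<open>z\<close>; the summand 1 keeps the denominator positive when both directions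
    vanish.\<close>
  define h where "h = d / (2 * (norm v + norm w + 1))"
  have pos: "norm v + norm w + 1 > 0" by (smt (verit) norm_ge_zero)
  have h: "h > 0" using d pos by (simp add: h_def)
  have near: "dist (z + s *\<^sub>R v + t *\<^sub>R w) z < d" if "0 \<le> s" "s \<le> h" "0 \<le> t" "t \<le> h" for s t
  proof -
    have "dist (z + s *\<^sub>R v + t *\<^sub>R w) z \<le> s * norm v + t * norm w"
      using norm_triangle_ineq[of "s *\<^sub>R v" "t *\<^sub>R w"] that by (simp add: dist_norm)
    also have "\<dots> \<le> h * norm v + h * norm w" using that by (intro add_mono mult_right_mono) auto
    also have "\<dots> \<le> h * (norm v + norm w + 1)" using h by (simp add: algebra_simps)
    also have "\<dots> = d / 2" using pos by (simp add: h_def field_simps)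
    finally show ?thesis using d by simp
  qed
  have inS: "z + s *\<^sub>R v + t *\<^sub>R w \<in> S" if "0 \<le> s" "s \<le> h" "0 \<le> t" "t \<le> h" for s t
    using near[OF that] d d3 by (auto simp: dist_commute subset_eq)
  have inS': "z + s *\<^sub>R w + t *\<^sub>R v \<in> S" if "0 \<le> s" "s \<le> h" "0 \<le> t" "t \<le> h" for s t
    using inS[of t s] that by (simp add: algebra_simps)
  obtain s t where 1: "0 \<le> s" "s \<le> h" "0 \<le> t" "t \<le> h" 
    "f (z + h *\<^sub>R v + h *\<^sub>R w) - f (z + h *\<^sub>R v) - f (z + h *\<^sub>R w) + f z = h\<^sup>2 * A (z + s *\<^sub>R v + t *\<^sub>R w)"
    using second_difference[OF C h inS] unfolding A_def by blast
  obtain s' t' where 2: "0 \<le> s'" "s' \<le> h" "0 \<le> t'" "t' \<le> h" 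
    "f (z + h *\<^sub>R w + h *\<^sub>R v) - f (z + h *\<^sub>R w) - f (z + h *\<^sub>R v) + f z = h\<^sup>2 * B (z + s' *\<^sub>R w + t' *\<^sub>R v)"
    using second_difference[OF C h inS'] unfolding B_def by blast
  have "h\<^sup>2 * A (z + s *\<^sub>R v + t *\<^sub>R w) = h\<^sup>2 * B (z + s' *\<^sub>R w + t' *\<^sub>R v)"
    using 1(5) 2(5) by (simp add: algebra_simps)
  then have "A (z + s *\<^sub>R v + t *\<^sub>R w) = B (z + s' *\<^sub>R w + t' *\<^sub>R v)" using h by simp
  moreover have "\<bar>A (z + s *\<^sub>R v + t *\<^sub>R w) - A z\<bar> < e"
    using near[of s t] 1 d by (intro d1(2)) auto
  moreover have "\<bar>B (z + s' *\<^sub>R w + t' *\<^sub>R v) - B z\<bar> < e"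
    using near[of t' s'] 2 d by (intro d2(2)) (auto simp: algebra_simps)
  ultimately show False unfolding e_def by argo
qed

text \<open>Only the outer direction expands by pointwise linearity. The inner one is first brought
  outside by symmetry, so that no identity has to be differentiated.\<close>

lemma dd2_expand:
  fixes f :: "'v::euclidean_space \<Rightarrow> real"
  assumes "Ck 2 f S" "open S" "z \<in> S"
  shows "dd v (dd w f) z = (\<Sum>a\<in>Basis. \<Sum>b\<in>Basis. (v \<bullet> a) * (w \<bullet> b) * dd a (dd b f) z)"
proof -
  have df: "f differentiable (at z)" "\<And>u. dd u f differentiable (at z)"
    using Ck_2D[OF assms(1)] assms(3) by auto
  have "dd v (dd w f) z = (\<Sum>a\<in>Basis. (v \<bullet> a) * dd a (dd w f) z)" by (rule dd_expand[OF df(2)])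
  also have "\<dots> = (\<Sum>a\<in>Basis. (v \<bullet> a) * dd w (dd a f) z)"
    by (simp only: dd_commute[OF assms, where w = w])
  also have "\<dots> = (\<Sum>a\<in>Basis. (v \<bullet> a) * (\<Sum>b\<in>Basis. (w \<bullet> b) * dd b (dd a f) z))"
    by (simp only: dd_expand[OF df(2), where v = w])
  also have "\<dots> = (\<Sum>a\<in>Basis. \<Sum>b\<in>Basis. (v \<bullet> a) * (w \<bullet> b) * dd a (dd b f) z)"
    by (intro sum.cong refl) (simp add: sum_distrib_left mult.assoc dd_commute[OF assms, of b for b])
  finally show ?thesis .
qed

lemma continuous_on_dd:
  fixes f :: "'v::euclidean_space \<Rightarrow> real"
  assumes "Ck 1 f S" "continuous_on T v" "continuous_on T h" "h ` T \<subseteq> S"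
  shows "continuous_on T (\<lambda>t. dd (v t) f (h t))"
proof -
  have "continuous_on T (\<lambda>t. \<Sum>b\<in>Basis. (v t \<bullet> b) * dd b f (h t))"
    by (intro continuous_on_sum continuous_on_mult continuous_on_inner continuous_on_const
        continuous_on_compose2[OF Ck_1D(2)[OF assms(1)] assms(3,4)] assms(2))
  moreover have "dd (v t) f (h t) = (\<Sum>b\<in>Basis. (v t \<bullet> b) * dd b f (h t))" if "t \<in> T" for t
    by (rule dd_expand, rule Ck_1D(1)[OF assms(1)]) (use assms(4) that in auto)
  ultimately show ?thesis by (simp cong: continuous_on_cong)
qed

lemma continuous_on_dd2:
  fixes f :: "'v::euclidean_space \<Rightarrow> real"
  assumes "Ck 2 f S" "open S" "continuous_on T v" "continuous_on T w" "continuous_on T h" "h ` T \<subseteq> S"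
  shows "continuous_on T (\<lambda>t. dd (v t) (dd (w t) f) (h t))"
proof -
  have "continuous_on T (\<lambda>t. \<Sum>a\<in>Basis. \<Sum>b\<in>Basis. (v t \<bullet> a) * (w t \<bullet> b) * dd a (dd b f) (h t))"
    by (intro continuous_on_sum continuous_on_mult continuous_on_inner continuous_on_const
        continuous_on_compose2[OF Ck_2D(3)[OF assms(1)] assms(5,6)] assms(3,4))
  moreover have "dd (v t) (dd (w t) f) (h t) = (\<Sum>a\<in>Basis. \<Sum>b\<in>Basis. (v t \<bullet> a) * (w t \<bullet> b) * dd a (dd b f) (h t))" if "t \<in> T" for t
    by (rule dd2_expand[OF assms(1,2)]) (use assms(6) that in auto)
  ultimately show ?thesis by (simp cong: continuous_on_cong)
qed

text \<open>The second derivative of \<open>f\<close> along a curve: the Hessian on the velocity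
  plus the gradient on the acceleration. In coordinates it is the product rule, followed by symmetry
  to reassemble the Hessian term.\<close>

lemma has_real_derivative_curve2:
  fixes f :: "'v::euclidean_space \<Rightarrow> real"
  assumes C: "Ck 2 f S" and "open S" "\<And>t. t \<in> T \<Longrightarrow> \<gamma> t \<in> S" "t \<in> T"
    and "(\<gamma> has_vector_derivative v t) (at t within T)"
    and "(v has_vector_derivative a) (at t within T)"
  shows "((\<lambda>t. dd (v t) f (\<gamma> t)) has_real_derivative dd (v t) (dd (v t) f) (\<gamma> t) + dd a f (\<gamma> t)) (at t within T)"
proof -
  have df: "f differentiable (at x)" "\<And>u. dd u f differentiable (at x)" if "x \<in> S" for x
    using Ck_2D[OF C] that by auto
  have der: "((\<lambda>t. \<Sum>b\<in>Basis. (v t \<bullet> b) * dd b f (\<gamma> t)) has_real_derivative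
      (\<Sum>b\<in>Basis. (v t \<bullet> b) * dd (v t) (dd b f) (\<gamma> t) + (a \<bullet> b) * dd b f (\<gamma> t))) (at t within T)"
  proof (rule DERIV_sum)
    fix b :: 'v
    have "((\<lambda>t. v t \<bullet> b) has_real_derivative a \<bullet> b) (at t within T)"
      using bounded_linear.has_vector_derivative[OF bounded_linear_inner_left assms(6), of b]
      by (simp add: has_real_derivative_iff_has_vector_derivative)
    from DERIV_mult[OF this has_real_derivative_curve[OF df(2) assms(5)]]
    show "((\<lambda>t. (v t \<bullet> b) * dd b f (\<gamma> t)) has_real_derivative
        (v t \<bullet> b) * dd (v t) (dd b f) (\<gamma> t) + (a \<bullet> b) * dd b f (\<gamma> t)) (at t within T)"
      using assms by (auto simp: algebra_simps)
  qed
  have inS: "\<gamma> t \<in> S" using assms(3,4) .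
  have "dd (v t) (dd (v t) f) (\<gamma> t) = (\<Sum>b\<in>Basis. (v t \<bullet> b) * dd b (dd (v t) f) (\<gamma> t))"
    by (rule dd_expand[OF df(2)[OF inS]])
  also have "\<dots> = (\<Sum>b\<in>Basis. (v t \<bullet> b) * dd (v t) (dd b f) (\<gamma> t))"
    by (simp only: dd_commute[OF C \<open>open S\<close> inS, where v = "v t"])
  finally have eq: "(\<Sum>b\<in>Basis. (v t \<bullet> b) * dd (v t) (dd b f) (\<gamma> t) + (a \<bullet> b) * dd b f (\<gamma> t))
      = dd (v t) (dd (v t) f) (\<gamma> t) + dd a f (\<gamma> t)"
    by (simp only: sum.distrib dd_expand[OF df(1)[OF inS], where v = a])
  show ?thesis
    by (rule has_field_derivative_transform[OF \<open>t \<in> T\<close> _ der[unfolded eq]])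
       (rule dd_expand[OF df(1)[OF assms(3)]])
qed

section \<open>Curves with affine image\<close>

text \<open>Solutions of a linear system depend continuously on matrix and right-hand side. An
  injective \<open>A0\<close> satisfies \<open>norm (A0 x) \<ge> m * norm x\<close>, matrices near
  it satisfy this with \<open>m / 2\<close>, and so the error of the solution is controlled by the
  error of its image.\<close>

lemma tendsto_linear_solve:
  fixes A :: "'t \<Rightarrow> 'a::euclidean_space \<Rightarrow> 'a"
  assumes lin: "\<forall>\<^sub>F t in F. linear (A t)" and lin0: "linear A0" "inj A0"
    and lim: "\<And>v. ((\<lambda>t. A t v) \<longlongrightarrow> A0 v) F"
    and w: "((\<lambda>t. A t (w t)) \<longlongrightarrow> A0 l) F"
  shows "(w \<longlongrightarrow> l) F"
proof -
  obtain m where m: "m > 0" "\<And>x. m * norm x \<le> norm (A0 x)"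
    using linear_inj_bounded_below_pos[OF lin0] by blast
  \<comment> \<open>\<open>E t\<close> dominates the operator norm of \<open>A t - A0\<close>; in
    finite dimension convergence on a basis is enough to make it small.\<close>
  define E where "E t = (\<Sum>b\<in>Basis. norm (A t b - A0 b))" for t
  have "(E \<longlongrightarrow> (\<Sum>b\<in>(Basis::'a set). norm (A0 b - A0 b))) F"
    unfolding E_def by (intro tendsto_intros lim)
  then have ev: "\<forall>\<^sub>F t in F. E t < m / 2" using m(1) by (intro order_tendstoD(2)) auto
  have diff: "norm (A t x - A0 x) \<le> E t * norm x" if "linear (A t)" for t x
  proof -
    interpret L: linear "\<lambda>x. A t x - A0 x" using that lin0(1) by (intro linear_compose_sub)
    have "A t x - A0 x = (\<lambda>x. A t x - A0 x) (\<Sum>b\<in>Basis. (x \<bullet> b) *\<^sub>R b)"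
      by (simp add: euclidean_representation)
    also have "\<dots> = (\<Sum>b\<in>Basis. (x \<bullet> b) *\<^sub>R (A t b - A0 b))"
      by (subst L.sum) (simp add: L.scale)
    also have "norm \<dots> \<le> (\<Sum>b\<in>Basis. norm x * norm (A t b - A0 b))"
      by (intro sum_norm_le) (auto intro!: mult_right_mono Basis_le_norm)
    finally show ?thesis by (simp add: E_def sum_distrib_left mult.commute)
  qed
  have below: "\<forall>\<^sub>F t in F. \<forall>x. m / 2 * norm x \<le> norm (A t x)"
    using ev lin
  proof eventually_elim
    case (elim t)
    show ?case
    proof
      fix x
      have "norm (A0 x) \<le> norm (A t x) + norm (A t x - A0 x)"
        by (metis norm_minus_commute norm_triangle_sub)
      also have "norm (A t x - A0 x) \<le> m / 2 * norm x"
        using diff[OF elim(2), of x] elim(1) by (meson less_eq_real_def mult_right_mono norm_ge_zero order_trans)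
      finally show "m / 2 * norm x \<le> norm (A t x)" using m(2)[of x] by simp
    qed
  qed
  have "((\<lambda>t. 2 / m * norm (A t (w t) - A t l)) \<longlongrightarrow> 2 / m * norm (A0 l - A0 l)) F"
    by (intro tendsto_intros w lim)
  then have *: "((\<lambda>t. 2 / m * norm (A t (w t) - A t l)) \<longlongrightarrow> 0) F" by simp
  have "\<forall>\<^sub>F t in F. norm (w t - l) \<le> 2 / m * norm (A t (w t) - A t l)"
    using below lin
  proof eventually_elim
    case (elim t)
    have "m / 2 * norm (w t - l) \<le> norm (A t (w t - l))" using elim by blast
    also have "A t (w t - l) = A t (w t) - A t l" using elim(2) by (rule linear_diff)
    finally show ?case using m(1) by (simp add: field_simps)
  qed
  from Lim_null_comparison[OF this *] show ?thesis by (simp add: LIM_zero_iff)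
qed

lemma has_vector_derivative_within:
  "(f has_vector_derivative d) (at t within T) \<longleftrightarrow>
    ((\<lambda>s. (1 / (s - t)) *\<^sub>R (f s - f t)) \<longlongrightarrow> d) (at t within T)"
proof -
  have "norm ((f s - f t) - (s - t) *\<^sub>R d) / norm (s - t) = norm ((1 / (s - t)) *\<^sub>R (f s - f t) - d)"
    if "s \<noteq> t" for s
  proof -
    have "(1 / (s - t)) *\<^sub>R (f s - f t) - d = (1 / (s - t)) *\<^sub>R ((f s - f t) - (s - t) *\<^sub>R d)"
      using that by (simp add: scaleR_right_diff_distrib)
    then show ?thesis by simp
  qed
  then have "(f has_vector_derivative d) (at t within T) \<longleftrightarrow>
      ((\<lambda>s. norm ((1 / (s - t)) *\<^sub>R (f s - f t) - d)) \<longlongrightarrow> 0) (at t within T)"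
    unfolding has_vector_derivative_def has_derivative_iff_norm
    by (simp add: bounded_linear_scaleR_left cong: Lim_cong_within)
  also have "\<dots> \<longleftrightarrow> ((\<lambda>s. (1 / (s - t)) *\<^sub>R (f s - f t)) \<longlongrightarrow> d) (at t within T)"
    unfolding tendsto_norm_zero_iff by (rule LIM_zero_iff)
  finally show ?thesis .
qed

text \<open>The differentiable inverse in \<open>diffeo_onto_range\<close> yields
  \<open>\<gamma>1\<close>. Differentiating \<open>\<phi> (\<gamma> t) = a + t b\<close> once and
  twice gives linear systems for velocity and acceleration with the invertible matrix D\<phi>, and
  \<open>tendsto_linear_solve\<close> transfers continuity and differentiability from the matrix to
  the solutions.\<close>

lemma inverse_curve:
  fixes \<phi> :: "'a::euclidean_space \<Rightarrow> 'a" and a b :: 'a and l r :: real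
  assumes diffeo: "diffeo_onto_range \<phi> S" and N: "open N" "S \<subseteq> N"
    and C2: "\<And>e. Ck 2 (\<lambda>x. \<phi> x \<bullet> e) N"
    and "l < r" and seg: "\<And>t. t \<in> {l..r} \<Longrightarrow> a + t *\<^sub>R b \<in> \<phi> ` S"
  defines "\<gamma> \<equiv> \<lambda>t. inv_into S \<phi> (a + t *\<^sub>R b)"
  obtains \<gamma>1 \<gamma>2 where
    "\<And>t. t \<in> {l..r} \<Longrightarrow> (\<gamma> has_vector_derivative \<gamma>1 t) (at t within {l..r})"
    "\<And>t. t \<in> {l..r} \<Longrightarrow> (\<gamma>1 has_vector_derivative \<gamma>2 t) (at t within {l..r})"
    "continuous_on {l..r} \<gamma>2"
    "\<And>t e. t \<in> {l..r} \<Longrightarrow> dd (\<gamma>1 t) (\<lambda>x. \<phi> x \<bullet> e) (\<gamma> t) = b \<bullet> e"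
    "\<And>t e. t \<in> {l..r} \<Longrightarrow>
      dd (\<gamma>1 t) (dd (\<gamma>1 t) (\<lambda>x. \<phi> x \<bullet> e)) (\<gamma> t) + dd (\<gamma>2 t) (\<lambda>x. \<phi> x \<bullet> e) (\<gamma> t) = 0"
proof -
  let ?T = "{l..r}"
  \<comment> \<open>The derivative of \<open>\<phi>\<close> at \<open>\<gamma> t\<close>, assembled
    from components because smoothness is assumed for the components.\<close>
  define A where "A t v = (\<Sum>e\<in>Basis. dd v (\<lambda>x. \<phi> x \<bullet> e) (\<gamma> t) *\<^sub>R e)" for t v
  have inS: "\<gamma> t \<in> S" and \<phi>\<gamma>: "\<phi> (\<gamma> t) = a + t *\<^sub>R b" if "t \<in> ?T" for t
    using seg[OF that] by (auto simp: \<gamma>_def f_inv_into_f inv_into_into)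
  have inN: "\<gamma> t \<in> N" if "t \<in> ?T" for t using inS[OF that] N by blast
  have df: "(\<lambda>x. \<phi> x \<bullet> e) differentiable (at x)" "dd u (\<lambda>x. \<phi> x \<bullet> e) differentiable (at x)"
    if "x \<in> N" for x e u
    using C2[of e] that by (auto simp: numeral_2_eq_2 Ck_Suc_dd)
  have A: "linear (A t)" "bij (A t)" if t: "t \<in> ?T" for t
  proof -
    obtain f' where f': "(\<phi> has_derivative f') (at (\<gamma> t))" "bij f'"
      using diffeo inS[OF t] by (auto simp: diffeo_onto_range_def)
    have "dd v (\<lambda>x. \<phi> x \<bullet> e) (\<gamma> t) = f' v \<bullet> e" for v e
      using f'(1) by (intro dd_eqI) (auto intro!: derivative_eq_intros)
    then have "A t = f'" by (simp add: A_def fun_eq_iff euclidean_representation)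
    then show "linear (A t)" "bij (A t)"
      using f' by (auto dest: has_derivative_bounded_linear bounded_linear.linear)
  qed
  have "\<exists>v. (\<gamma> has_vector_derivative v) (at t within ?T)" if t: "t \<in> ?T" for t
  proof -
    let ?p = "a + t *\<^sub>R b"
    obtain g' where g': "(inv_into S \<phi> has_derivative g') (at ?p within \<phi> ` S)"
      using diffeo seg[OF t] by (auto simp: diffeo_onto_range_def)
    have line: "((\<lambda>t. a + t *\<^sub>R b) has_derivative (\<lambda>h. h *\<^sub>R b)) (at t within ?T)"
      by (auto intro!: derivative_eq_intros)
    have "(\<gamma> has_derivative (\<lambda>h. g' (h *\<^sub>R b))) (at t within ?T)"
      unfolding \<gamma>_def
      by (intro has_derivative_in_compose[OF line]
           has_derivative_subset[OF g']) (use seg in auto)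
    moreover have "linear g'" using g' has_derivative_linear by blast
    ultimately show ?thesis
      by (auto simp: has_vector_derivative_def linear_scale intro!: exI[of _ "g' b"])
  qed
  then obtain \<gamma>1 where \<gamma>1: "\<And>t. t \<in> ?T \<Longrightarrow> (\<gamma> has_vector_derivative \<gamma>1 t) (at t within ?T)" by metis
  have ev: "\<forall>\<^sub>F s in at t within ?T. s \<in> ?T" for t
    by (simp add: eventually_at_filter)
  have nontriv: "at t within ?T \<noteq> bot" if "t \<in> ?T" for t
    using that \<open>l < r\<close> by (simp add: trivial_limit_within islimpt_Icc)
  have eq1: "dd (\<gamma>1 t) (\<lambda>x. \<phi> x \<bullet> e) (\<gamma> t) = b \<bullet> e" if "t \<in> ?T" for t e
  proof -
    have "((\<lambda>t. \<phi> (\<gamma> t) \<bullet> e) has_real_derivative dd (\<gamma>1 t) (\<lambda>x. \<phi> x \<bullet> e) (\<gamma> t)) (at t within ?T)"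
      by (rule has_real_derivative_curve[OF df(1)[OF inN[OF that]] \<gamma>1[OF that]])
    moreover have "((\<lambda>t. \<phi> (\<gamma> t) \<bullet> e) has_real_derivative b \<bullet> e) (at t within ?T)"
      by (rule has_field_derivative_transform[OF that, where f = "\<lambda>t. (a + t *\<^sub>R b) \<bullet> e"])
         (auto simp: \<phi>\<gamma> inner_add_left intro!: derivative_eq_intros)
    ultimately show ?thesis
      using vector_derivative_unique_within[OF nontriv[OF that]]
      by (simp add: has_real_derivative_iff_has_vector_derivative)
  qed
  have A1: "A t (\<gamma>1 t) = b" if "t \<in> ?T" for t
    using eq1[OF that] by (simp add: A_def euclidean_representation)
  have cont\<gamma>: "continuous_on ?T \<gamma>"
    using \<gamma>1 has_vector_derivative_continuous continuous_on_eq_continuous_within by blast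
  have limA: "((\<lambda>s. A s v) \<longlongrightarrow> A t v) (at t within ?T)" if "t \<in> ?T" for t v
  proof -
    have "continuous_on ?T (\<lambda>s. A s v)"
      unfolding A_def using inN cont\<gamma>
      by (intro continuous_intros continuous_on_dd[OF Ck_mono[OF C2]]) auto
    then show ?thesis using that by (simp add: continuous_on_def)
  qed
  have evlin: "\<forall>\<^sub>F s in at t within ?T. linear (A s)" for t
    using ev[of t] by eventually_elim (rule A)
  have lim1: "(\<gamma>1 \<longlongrightarrow> \<gamma>1 t) (at t within ?T)" if "t \<in> ?T" for t
  proof (rule tendsto_linear_solve[OF evlin, of "A t"])
    show "((\<lambda>s. A s (\<gamma>1 s)) \<longlongrightarrow> A t (\<gamma>1 t)) (at t within ?T)"
      by (rule tendsto_eventually, use ev[of t] in eventually_elim) (simp add: A1 A1[OF that])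
  qed (use A that limA in \<open>auto simp: bij_def\<close>)
  then have cont\<gamma>1: "continuous_on ?T \<gamma>1" by (simp add: continuous_on_def)
  define H where "H t = (\<Sum>e\<in>Basis. dd (\<gamma>1 t) (dd (\<gamma>1 t) (\<lambda>x. \<phi> x \<bullet> e)) (\<gamma> t) *\<^sub>R e)" for t
  \<comment> \<open>The only possible acceleration: differentiating
    \<open>A t (\<gamma>1 t) = b\<close> gives \<open>H t + A t (\<gamma>2 t) = 0\<close>.\<close>
  define \<gamma>2 where "\<gamma>2 t = inv (A t) (- H t)" for t
  have A2: "A t (\<gamma>2 t) = - H t" if "t \<in> ?T" for t
    using A(2)[OF that] by (simp add: \<gamma>2_def bij_is_surj surj_f_inv_f)
  have der2: "(\<gamma>1 has_vector_derivative \<gamma>2 t) (at t within ?T)" if t: "t \<in> ?T" for t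
  proof -
    let ?F = "at t within ?T"
    have "((\<lambda>s. (1 / (s - t)) *\<^sub>R (\<gamma>1 s - \<gamma>1 t)) \<longlongrightarrow> \<gamma>2 t) ?F"
    proof (rule tendsto_linear_solve[OF evlin, of "A t"])
      have "((\<lambda>s. A s (\<gamma>1 t)) has_vector_derivative H t) ?F"
        unfolding A_def H_def
      proof (rule has_vector_derivative_sum)
        fix e
        have "((\<lambda>s. dd (\<gamma>1 t) (\<lambda>x. \<phi> x \<bullet> e) (\<gamma> s)) has_real_derivative 
           dd (\<gamma>1 t) (dd (\<gamma>1 t) (\<lambda>x. \<phi> x \<bullet> e)) (\<gamma> t)) ?F"
          by (rule has_real_derivative_curve[OF df(2)[OF inN[OF t]] \<gamma>1[OF t]])
        then show "((\<lambda>s. dd (\<gamma>1 t) (\<lambda>x. \<phi> x \<bullet> e) (\<gamma> s) *\<^sub>R e) has_vector_derivative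
           dd (\<gamma>1 t) (dd (\<gamma>1 t) (\<lambda>x. \<phi> x \<bullet> e)) (\<gamma> t) *\<^sub>R e) ?F"
          by (auto intro!: derivative_eq_intros)
      qed
      then have "((\<lambda>s. (1 / (s - t)) *\<^sub>R (A s (\<gamma>1 t) - A t (\<gamma>1 t))) \<longlongrightarrow> H t) ?F"
        by (simp add: has_vector_derivative_within)
      then have "((\<lambda>s. - ((1 / (s - t)) *\<^sub>R (A s (\<gamma>1 t) - A t (\<gamma>1 t)))) \<longlongrightarrow> - H t) ?F"
        by (rule tendsto_minus)
      then show "((\<lambda>s. A s ((1 / (s - t)) *\<^sub>R (\<gamma>1 s - \<gamma>1 t))) \<longlongrightarrow> A t (\<gamma>2 t)) ?F"
        unfolding A2[OF t]
      proof (rule Lim_transform_eventually)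
        show "\<forall>\<^sub>F s in ?F. - ((1 / (s - t)) *\<^sub>R (A s (\<gamma>1 t) - A t (\<gamma>1 t))) = A s ((1 / (s - t)) *\<^sub>R (\<gamma>1 s - \<gamma>1 t))"
          using ev[of t]
        proof eventually_elim
          case (elim s)
          have "A s ((1 / (s - t)) *\<^sub>R (\<gamma>1 s - \<gamma>1 t)) = (1 / (s - t)) *\<^sub>R (A s (\<gamma>1 s) - A s (\<gamma>1 t))"
            using A(1)[OF elim] by (simp add: linear_scale linear_diff)
          also have "\<dots> = - ((1 / (s - t)) *\<^sub>R (A s (\<gamma>1 t) - A t (\<gamma>1 t)))"
            unfolding A1[OF elim] A1[OF t] by (simp flip: scaleR_minus_right)
          finally show ?case by simp
        qed
      qed
    qed (use A t limA in \<open>auto simp: bij_def\<close>)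
    then show ?thesis
      by (simp add: has_vector_derivative_within)
  qed
  have contH: "continuous_on ?T H"
    unfolding H_def using inN cont\<gamma> cont\<gamma>1
    by (intro continuous_intros continuous_on_dd2[OF C2 N(1)]) auto
  have "continuous_on ?T \<gamma>2"
    unfolding continuous_on_def
  proof
    fix t assume t: "t \<in> ?T"
    show "(\<gamma>2 \<longlongrightarrow> \<gamma>2 t) (at t within ?T)"
    proof (rule tendsto_linear_solve[OF evlin, of "A t"])
      have "((\<lambda>s. - H s) \<longlongrightarrow> - H t) (at t within ?T)"
        using contH t by (intro tendsto_minus) (auto simp: continuous_on_def)
      then show "((\<lambda>s. A s (\<gamma>2 s)) \<longlongrightarrow> A t (\<gamma>2 t)) (at t within ?T)"
        unfolding A2[OF t]
        by (rule Lim_transform_eventually) (use ev[of t] in eventually_elim, simp add: A2)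
    qed (use A t limA in \<open>auto simp: bij_def\<close>)
  qed
  moreover have "dd (\<gamma>1 t) (dd (\<gamma>1 t) (\<lambda>x. \<phi> x \<bullet> e)) (\<gamma> t) + dd (\<gamma>2 t) (\<lambda>x. \<phi> x \<bullet> e) (\<gamma> t) = 0"
    if t: "t \<in> ?T" for t e
  proof -
    have "((\<lambda>t. dd (\<gamma>1 t) (\<lambda>x. \<phi> x \<bullet> e) (\<gamma> t)) has_real_derivative
       dd (\<gamma>1 t) (dd (\<gamma>1 t) (\<lambda>x. \<phi> x \<bullet> e)) (\<gamma> t) + dd (\<gamma>2 t) (\<lambda>x. \<phi> x \<bullet> e) (\<gamma> t)) (at t within ?T)"
      by (rule has_real_derivative_curve2[OF C2 N(1) inN t \<gamma>1[OF t] der2[OF t]])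
    moreover have "((\<lambda>t. dd (\<gamma>1 t) (\<lambda>x. \<phi> x \<bullet> e) (\<gamma> t)) has_real_derivative 0) (at t within ?T)"
      by (rule has_field_derivative_transform[OF t, where f = "\<lambda>t. b \<bullet> e"]) (auto simp: eq1)
    ultimately show ?thesis
      using vector_derivative_unique_within[OF nontriv[OF t]]
      by (simp add: has_real_derivative_iff_has_vector_derivative)
  qed
  ultimately show ?thesis using that \<gamma>1 der2 eq1 by blast
qed

section \<open>Symmetry and homogeneity of higher directional derivatives\<close>

lemma dd_congD:
  assumes "open S" "Ck 1 f S" "z \<in> S" "\<And>x. x \<in> S \<Longrightarrow> f x = g x"
  shows "dd v f z = dd v g z"
  using dd_cong_open(1)[OF assms(1,3,4) Ck_1D(1)[OF assms(2,3)]] .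

text \<open>Two transpositions. The inner one is subsequently differentiated, so it must hold on a
  whole open set and not merely at \<open>z\<close>.\<close>

lemma dd_rotate3:
  assumes "Ck 3 f S" "open S" "z \<in> S"
  shows "dd u (dd v (dd w f)) z = dd w (dd u (dd v f)) z"
proof -
  have f2: "Ck 2 f S" by (rule Ck_mono[OF assms(1)]) simp
  have d2: "Ck 2 (dd a f) S" for a
    using assms(1) by - (rule Ck_dd, simp add: eval_nat_numeral)
  have d1: "Ck 1 (dd a (dd b f)) S" for a b
    using d2[of b] by - (rule Ck_dd, simp add: eval_nat_numeral)
  have "dd u (dd v (dd w f)) z = dd u (dd w (dd v f)) z"
    by (rule dd_congD[OF assms(2) d1 assms(3)]) (rule dd_commute[OF f2 assms(2)])
  also have "\<dots> = dd w (dd u (dd v f)) z" by (rule dd_commute[OF d2 assms(2,3)])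
  finally show ?thesis .
qed

text \<open>Each rotation carries one \<open>dd b\<close> outward past both \<open>dd a\<close>. The
  curvature conditions differentiate in y first, while the argument studies the second x-derivative
  as a function of y; this lemma passes between the two orders.\<close>

lemma dd_swap_pairs:
  assumes "Ck 4 f S" "open S" "z \<in> S"
  shows "dd a (dd a (dd b (dd b f))) z = dd b (dd b (dd a (dd a f))) z"
proof -
  have f3: "Ck 3 f S" by (rule Ck_mono[OF assms(1)]) simp
  have d3: "Ck 3 (dd v f) S" for v
    using assms(1) by - (rule Ck_dd, simp add: eval_nat_numeral)
  have d2: "Ck 2 (dd v (dd w f)) S" for v w
    using d3[of w] by - (rule Ck_dd, simp add: eval_nat_numeral)
  have d1: "Ck 1 (dd u (dd v (dd w f))) S" for u v w
    using d2[of v w] by - (rule Ck_dd, simp add: eval_nat_numeral)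
  have "dd a (dd a (dd b (dd b f))) z = dd b (dd a (dd a (dd b f))) z"
    by (rule dd_rotate3[OF d3 assms(2,3)])
  also have "\<dots> = dd b (dd b (dd a (dd a f))) z"
    by (rule dd_congD[OF assms(2) d1 assms(3)]) (rule dd_rotate3[OF f3 assms(2)])
  finally show ?thesis .
qed

lemma dd_scale:
  assumes "f differentiable (at z)"
  shows "dd (r *\<^sub>R v) f z = r * dd v f z"
  using linear_scale[OF dd_linear[OF assms]] by simp

lemma dd2_scale:
  fixes f :: "'v::euclidean_space \<Rightarrow> real"
  assumes "Ck 2 f S" "open S" "z \<in> S"
  shows "dd (r *\<^sub>R v) (dd (r *\<^sub>R v) f) z = r\<^sup>2 * dd v (dd v f) z"
proof -
  have "dd (r *\<^sub>R v) (dd (r *\<^sub>R v) f) z =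
      (\<Sum>a\<in>Basis. \<Sum>b\<in>Basis. r\<^sup>2 * ((v \<bullet> a) * (v \<bullet> b) * dd a (dd b f) z))"
    by (subst dd2_expand[OF assms], intro sum.cong refl) (simp add: power2_eq_square mult_ac)
  also have "\<dots> = r\<^sup>2 * dd v (dd v f) z"
    by (simp only: sum_distrib_left dd2_expand[OF assms, where v = v and w = v])
  finally show ?thesis .
qed

text \<open>Pulls a scalar out from under a derivative when the proportionality is known only on the
  open set, as happens when \<open>g\<close> is itself an iterated derivative.\<close>

lemma dd_cmult_on:
  fixes f :: "'v::euclidean_space \<Rightarrow> real"
  assumes "Ck 1 f S" "open S" "z \<in> S" "\<And>x. x \<in> S \<Longrightarrow> g x = k * f x"
  shows "dd v g z = k * dd v f z"
proof -
  have f: "f differentiable (at z)" by (rule Ck_1D(1)[OF assms(1,3)])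
  have "dd v (\<lambda>x. k * f x) z = dd v g z"
    using f by (intro dd_cong_open(1)[OF assms(2,3)]) (auto simp: assms(4) intro!: derivative_intros)
  then show ?thesis by (simp add: dd_cmult[OF f])
qed

lemma dd2_cmult_on:
  fixes f :: "'v::euclidean_space \<Rightarrow> real"
  assumes "Ck 2 f S" "open S" "z \<in> S" "\<And>x. x \<in> S \<Longrightarrow> g x = k * f x"
  shows "dd v (dd w g) z = k * dd v (dd w f) z"
proof (rule dd_cmult_on[OF _ assms(2,3)])
  show "Ck 1 (dd w f) S" using assms(1) by - (rule Ck_dd, simp add: eval_nat_numeral)
  show "dd w g x = k * dd w f x" if "x \<in> S" for x
    by (rule dd_cmult_on[OF Ck_mono[OF assms(1)] assms(2) that assms(4)]) simp_all
qed

section \<open>Segments in the coordinates given by the cost\<close>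

lemma grad_inner:
  assumes "(f has_derivative f') (at x)"
  shows "grad f x \<bullet> e = f' e"
proof -
  interpret linear f' using has_derivative_linear[OF assms] .
  have "grad f x \<bullet> e = (\<Sum>b\<in>Basis. f' b * (b \<bullet> e))"
    using frechet_derivative_at[OF assms] by (simp add: grad_def inner_sum_left)
  also have "\<dots> = f' (\<Sum>b\<in>Basis. (e \<bullet> b) *\<^sub>R b)"
    by (simp add: sum scale inner_commute mult.commute del: euclidean_representation)
  finally show ?thesis by (simp add: euclidean_representation)
qed

lemma has_derivative_slice:
  assumes "f differentiable (at (x, y))"
  shows "((\<lambda>x. f (x, y)) has_derivative (\<lambda>v. dd (v, 0) f (x, y))) (at x)"
    and "((\<lambda>y. f (x, y)) has_derivative (\<lambda>v. dd (0, v) f (x, y))) (at y)"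
proof -
  have f: "(f has_derivative (\<lambda>v. dd v f (x, y))) (at (x, y))"
    using assms by (simp add: dd_def frechet_derivative_works)
  have "((\<lambda>x. (x, y)) has_derivative (\<lambda>v. (v, 0))) (at x)"
    and "((\<lambda>y. (x, y)) has_derivative (\<lambda>v. (0, v))) (at y)"
    by (intro has_derivative_Pair has_derivative_ident has_derivative_const)+
  from this[THEN has_derivative_compose, OF f]
  show "((\<lambda>x. f (x, y)) has_derivative (\<lambda>v. dd (v, 0) f (x, y))) (at x)"
    and "((\<lambda>y. f (x, y)) has_derivative (\<lambda>v. dd (0, v) f (x, y))) (at y)" .
qed

lemma Ck_slice:
  fixes f :: "'a::euclidean_space \<times> 'a \<Rightarrow> real"
  assumes "Ck k f S" "open S"
  shows "Ck k (\<lambda>x. f (x, y)) {x. (x, y) \<in> S}" "open {x. (x, y) \<in> S}"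
    and "Ck k (\<lambda>y. f (x, y)) {y. (x, y) \<in> S}" "open {y. (x, y) \<in> S}"
proof -
  show "Ck k (\<lambda>x. f (x, y)) {x. (x, y) \<in> S}"
    using Ck_affine[OF _ assms(2,1), of "\<lambda>x. (x, 0)" "(0, y)"]
    by (simp add: bounded_linear_Pair bounded_linear_ident bounded_linear_zero)
  show "Ck k (\<lambda>y. f (x, y)) {y. (x, y) \<in> S}"
    using Ck_affine[OF _ assms(2,1), of "\<lambda>y. (0, y)" "(x, 0)"]
    by (simp add: bounded_linear_Pair bounded_linear_ident bounded_linear_zero)
  have c1: "continuous_on UNIV (\<lambda>x. (x, y))" and c2: "continuous_on UNIV (\<lambda>y. (x, y))"
    by (intro continuous_intros)+
  show "open {x. (x, y) \<in> S}" using open_vimage[OF assms(2) c1] by (simp add: vimage_def)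
  show "open {y. (x, y) \<in> S}" using open_vimage[OF assms(2) c2] by (simp add: vimage_def)
qed

text \<open>Invariance of domain makes the image of the open part open; compactness of the closure
  makes the full image closed and the inverse continuous. Thus the closed range is the closure of an
  open set, to which (B2) applies.\<close>

lemma diffeo_onto_range_closure:
  fixes \<phi> :: "'a::euclidean_space \<Rightarrow> 'a"
  assumes d: "diffeo_onto_range \<phi> (closure S)" and S: "open S" "bounded S"
  shows "continuous_on (closure S) \<phi>" "open (\<phi> ` S)" "\<phi> ` closure S = closure (\<phi> ` S)"
    "continuous_on (\<phi> ` closure S) (inv_into (closure S) \<phi>)"
proof -
  have inj: "inj_on \<phi> (closure S)" using d by (simp add: diffeo_onto_range_def)
  show cont: "continuous_on (closure S) \<phi>"
  proof (rule continuous_at_imp_continuous_on, rule ballI)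
    fix x assume "x \<in> closure S"
    then obtain f' where "(\<phi> has_derivative f') (at x)"
      using d by (auto simp: diffeo_onto_range_def)
    then show "isCont \<phi> x" by (rule has_derivative_continuous)
  qed
  show "open (\<phi> ` S)"
    using S(1) continuous_on_subset[OF cont closure_subset] inj_on_subset[OF inj closure_subset]
    by (rule invariance_of_domain_gen) simp
  have comp: "compact (closure S)" using S(2) by (simp add: compact_closure)
  show "continuous_on (\<phi> ` closure S) (inv_into (closure S) \<phi>)"
    by (rule continuous_on_inv[OF cont comp]) (simp add: inj)
  show "\<phi> ` closure S = closure (\<phi> ` S)"
  proof
    show "\<phi> ` closure S \<subseteq> closure (\<phi> ` S)"
      by (rule image_closure_subset[OF cont]) (simp_all add: closure_subset)
    show "closure (\<phi> ` S) \<subseteq> \<phi> ` closure S"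
      by (rule closure_minimal) (intro image_mono closure_subset
          compact_imp_closed compact_continuous_image[OF cont comp])+
  qed
qed

text \<open>\<open>W\<close> is a neighbourhood witnessing the smoothness of the cost up to the
  boundary. \<open>A3w\<close> and \<open>B3\<close> stay outside because they enter the lemmas as
  alternatives.\<close>

locale c_domain =
  fixes U V :: "'a::euclidean_space set" and c :: "'a \<Rightarrow> 'a \<Rightarrow> real" and W :: "('a \<times> 'a) set"
  assumes U: "open U" "bounded U" and V: "open V" "bounded V"
    and W: "open W" "closure U \<times> closure V \<subseteq> W"
    and C4: "Ck 4 (\<lambda>z. c (fst z) (snd z)) W"
    and B1: "B1 U V c" and B2: "B2 U V c"
begin

abbreviation C :: "'a \<times> 'a \<Rightarrow> real" where "C \<equiv> \<lambda>z. c (fst z) (snd z)"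

lemma inW: "x \<in> closure U \<Longrightarrow> y \<in> closure V \<Longrightarrow> (x, y) \<in> W"
  using W(2) by auto

lemma C_smooth: "Ck 2 C W" "Ck 3 C W" "Ck 3 (dd u C) W" "Ck 2 (dd u C) W" "Ck 2 (dd u (dd v C)) W"
  "Ck 1 (dd u (dd v (dd w C))) W"
proof -
  show "Ck 2 C W" "Ck 3 C W" by (rule Ck_mono[OF C4], simp)+
  show d3: "Ck 3 (dd u C) W" for u
    using C4 by - (rule Ck_dd, simp add: eval_nat_numeral)
  show "Ck 2 (dd u C) W" by (rule Ck_mono[OF d3]) simp
  show d2: "Ck 2 (dd u (dd v C)) W" for u v
    using d3 by - (rule Ck_dd, simp add: eval_nat_numeral)
  show "Ck 1 (dd u (dd v (dd w C))) W"
    using d2 by - (rule Ck_dd, simp add: eval_nat_numeral)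
qed

lemma C_diff:
  assumes "z \<in> W"
  shows "C differentiable (at z)" "dd u C differentiable (at z)" "dd u (dd v C) differentiable (at z)"
    "dd u (dd v (dd w C)) differentiable (at z)"
  using Ck_2D(1,2)[OF C_smooth(1) assms] Ck_2D(1,2)[OF C_smooth(5) assms] by blast+

lemma Dy_inner: "(x, y) \<in> W \<Longrightarrow> Dy c x y \<bullet> e = dd (0, e) C (x, y)"
  using grad_inner[OF has_derivative_slice(2)[OF C_diff(1)]] by (simp add: Dy_def)

lemma Dx_inner: "(x, y) \<in> W \<Longrightarrow> Dx c x y \<bullet> e = dd (e, 0) C (x, y)"
  using grad_inner[OF has_derivative_slice(1)[OF C_diff(1)]] by (simp add: Dx_def)

lemma diffeo_x: "y \<in> closure V \<Longrightarrow> diffeo_onto_range (\<lambda>x. - Dy c x y) (closure U)"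
  and diffeo_y: "x \<in> closure U \<Longrightarrow> diffeo_onto_range (\<lambda>y. - Dx c x y) (closure V)"
  using B1 by (auto simp: B1_def)

lemma slice_smooth:
  "Ck 2 (\<lambda>x. (- Dy c x y) \<bullet> e) {x. (x, y) \<in> W}"
  "Ck 2 (\<lambda>y. (- Dx c x y) \<bullet> e) {y. (x, y) \<in> W}"
proof -
  show "Ck 2 (\<lambda>x. (- Dy c x y) \<bullet> e) {x. (x, y) \<in> W}"
    by (rule Ck_cong_open[OF Ck_slice(2)[OF C_smooth(1) W(1)] _ Ck_slice(1)[OF C_smooth(4)[of "(0, - e)"] W(1)]])
       (use Dy_inner[where e = "- e"] in auto)
  show "Ck 2 (\<lambda>y. (- Dx c x y) \<bullet> e) {y. (x, y) \<in> W}"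
    by (rule Ck_cong_open[OF Ck_slice(4)[OF C_smooth(1) W(1)] _ Ck_slice(3)[OF C_smooth(4)[of "(- e, 0)"] W(1)]])
       (use Dx_inner[where e = "- e"] in auto)
qed

text \<open>Translates what \<open>inverse_curve\<close> says about the slice map into derivatives
  of \<open>C\<close> on the product space. The minus sign of the coordinates is carried by the
  direction \<open>- e\<close>.\<close>

lemma slice_dd_x:
  assumes "(x, y) \<in> W"
  shows "dd v (\<lambda>x. (- Dy c x y) \<bullet> e) x = dd (v, 0) (dd (0, - e) C) (x, y)"
    and "dd w (dd v (\<lambda>x. (- Dy c x y) \<bullet> e)) x = dd (w, 0) (dd (v, 0) (dd (0, - e) C)) (x, y)"
proof -
  have 1: "dd v (\<lambda>x. (- Dy c x y) \<bullet> e) x = dd (v, 0) (dd (0, - e) C) (x, y)" if "(x, y) \<in> W" for x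
  proof -
    have "dd v (\<lambda>x. dd (0, - e) C (x, y)) x = dd v (\<lambda>x. (- Dy c x y) \<bullet> e) x"
      by (rule dd_congD[OF Ck_slice(2)[OF C_smooth(4) W(1)]
            Ck_mono[OF Ck_slice(1)[OF C_smooth(4) W(1)]]])
         (use that Dy_inner[where e = "- e"] in auto)
    then show ?thesis
      using dd_eqI[OF has_derivative_slice(1)[OF C_diff(2)[OF that]], of v "(0, - e)"] by simp
  qed
  show "dd v (\<lambda>x. (- Dy c x y) \<bullet> e) x = dd (v, 0) (dd (0, - e) C) (x, y)" by (rule 1[OF assms])
  have "dd w (\<lambda>x. dd (v, 0) (dd (0, - e) C) (x, y)) x = dd w (dd v (\<lambda>x. (- Dy c x y) \<bullet> e)) x"
    by (rule dd_congD[OF Ck_slice(2)[OF C_smooth(4) W(1)]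
            Ck_mono[OF Ck_slice(1)[OF C_smooth(5) W(1)]]])
       (use assms 1 in auto)
  then show "dd w (dd v (\<lambda>x. (- Dy c x y) \<bullet> e)) x = dd (w, 0) (dd (v, 0) (dd (0, - e) C)) (x, y)"
    using dd_eqI[OF has_derivative_slice(1)[OF C_diff(3)[OF assms]], of w "(v, 0)" "(0, - e)"] by simp
qed

lemma slice_dd_y:
  assumes "(x, y) \<in> W"
  shows "dd v (\<lambda>y. (- Dx c x y) \<bullet> e) y = dd (0, v) (dd (- e, 0) C) (x, y)"
    and "dd w (dd v (\<lambda>y. (- Dx c x y) \<bullet> e)) y = dd (0, w) (dd (0, v) (dd (- e, 0) C)) (x, y)"
proof -
  have 1: "dd v (\<lambda>y. (- Dx c x y) \<bullet> e) y = dd (0, v) (dd (- e, 0) C) (x, y)" if "(x, y) \<in> W" for y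
  proof -
    have "dd v (\<lambda>y. dd (- e, 0) C (x, y)) y = dd v (\<lambda>y. (- Dx c x y) \<bullet> e) y"
      by (rule dd_congD[OF Ck_slice(4)[OF C_smooth(4) W(1)]
            Ck_mono[OF Ck_slice(3)[OF C_smooth(4) W(1)]]])
         (use that Dx_inner[where e = "- e"] in auto)
    then show ?thesis
      using dd_eqI[OF has_derivative_slice(2)[OF C_diff(2)[OF that]], of v "(- e, 0)"] by simp
  qed
  show "dd v (\<lambda>y. (- Dx c x y) \<bullet> e) y = dd (0, v) (dd (- e, 0) C) (x, y)" by (rule 1[OF assms])
  have "dd w (\<lambda>y. dd (0, v) (dd (- e, 0) C) (x, y)) y = dd w (dd v (\<lambda>y. (- Dx c x y) \<bullet> e)) y"
    by (rule dd_congD[OF Ck_slice(4)[OF C_smooth(4) W(1)]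
            Ck_mono[OF Ck_slice(3)[OF C_smooth(5) W(1)]]])
       (use assms 1 in auto)
  then show "dd w (dd v (\<lambda>y. (- Dx c x y) \<bullet> e)) y = dd (0, w) (dd (0, v) (dd (- e, 0) C)) (x, y)"
    using dd_eqI[OF has_derivative_slice(2)[OF C_diff(3)[OF assms]], of w "(0, v)" "(- e, 0)"] by simp
qed

text \<open>\<open>inverse_curve\<close> for the coordinate map belonging to \<open>y\<close>. The
  last two equations are the first and second derivative of
  \<open>- Dy c (\<gamma> t) y = a + t b\<close>, tested against a vector \<open>e\<close>.\<close>

lemma x_segment:
  fixes a b :: 'a
  assumes y: "y \<in> closure V" and "l < r"
    and seg: "\<And>t. t \<in> {l..r} \<Longrightarrow> a + t *\<^sub>R b \<in> (\<lambda>x. - Dy c x y) ` closure U"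
  defines "\<gamma> \<equiv> \<lambda>t. inv_into (closure U) (\<lambda>x. - Dy c x y) (a + t *\<^sub>R b)"
  obtains \<gamma>1 \<gamma>2 where
    "\<And>t. t \<in> {l..r} \<Longrightarrow> (\<gamma> has_vector_derivative \<gamma>1 t) (at t within {l..r})"
    "\<And>t. t \<in> {l..r} \<Longrightarrow> (\<gamma>1 has_vector_derivative \<gamma>2 t) (at t within {l..r})"
    "continuous_on {l..r} \<gamma>2"
    "\<And>t e. t \<in> {l..r} \<Longrightarrow> dd (\<gamma>1 t, 0) (dd (0, e) C) (\<gamma> t, y) = - (b \<bullet> e)"
    "\<And>t e. t \<in> {l..r} \<Longrightarrow>
      dd (\<gamma>1 t, 0) (dd (\<gamma>1 t, 0) (dd (0, e) C)) (\<gamma> t, y) + dd (\<gamma>2 t, 0) (dd (0, e) C) (\<gamma> t, y) = 0"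
proof -
  have mem: "(\<gamma> t, y) \<in> W" if "t \<in> {l..r}" for t
    using seg[OF that] y by (auto simp: \<gamma>_def intro!: inW inv_into_into)
  have sub: "closure U \<subseteq> {x. (x, y) \<in> W}" using y inW by auto
  obtain \<gamma>1 \<gamma>2 where
    \<gamma>: "\<And>t. t \<in> {l..r} \<Longrightarrow> (\<gamma> has_vector_derivative \<gamma>1 t) (at t within {l..r})"
    "\<And>t. t \<in> {l..r} \<Longrightarrow> (\<gamma>1 has_vector_derivative \<gamma>2 t) (at t within {l..r})"
    "continuous_on {l..r} \<gamma>2"
    "\<And>t e. t \<in> {l..r} \<Longrightarrow> dd (\<gamma>1 t) (\<lambda>x. (- Dy c x y) \<bullet> e) (\<gamma> t) = b \<bullet> e"
    "\<And>t e. t \<in> {l..r} \<Longrightarrow>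
      dd (\<gamma>1 t) (dd (\<gamma>1 t) (\<lambda>x. (- Dy c x y) \<bullet> e)) (\<gamma> t) + dd (\<gamma>2 t) (\<lambda>x. (- Dy c x y) \<bullet> e) (\<gamma> t) = 0"
    using inverse_curve[OF diffeo_x[OF y] Ck_slice(2)[OF C_smooth(1) W(1)] sub slice_smooth(1) \<open>l < r\<close> seg]
    unfolding \<gamma>_def by blast
  show ?thesis
  proof (rule that[OF \<gamma>(1-3)])
    fix t e assume t: "t \<in> {l..r}"
    show "dd (\<gamma>1 t, 0) (dd (0, e) C) (\<gamma> t, y) = - (b \<bullet> e)"
      using \<gamma>(4)[OF t, of "- e"] slice_dd_x(1)[OF mem[OF t], of _ "- e"] by simp
    show "dd (\<gamma>1 t, 0) (dd (\<gamma>1 t, 0) (dd (0, e) C)) (\<gamma> t, y) + dd (\<gamma>2 t, 0) (dd (0, e) C) (\<gamma> t, y) = 0"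
      using \<gamma>(5)[OF t, of "- e"] slice_dd_x[OF mem[OF t], where e = "- e"] by simp
  qed
qed

lemma y_segment:
  fixes a b :: 'a
  assumes x: "x \<in> closure U" and "l < r"
    and seg: "\<And>t. t \<in> {l..r} \<Longrightarrow> a + t *\<^sub>R b \<in> (\<lambda>y. - Dx c x y) ` closure V"
  defines "\<gamma> \<equiv> \<lambda>t. inv_into (closure V) (\<lambda>y. - Dx c x y) (a + t *\<^sub>R b)"
  obtains \<gamma>1 \<gamma>2 where
    "\<And>t. t \<in> {l..r} \<Longrightarrow> (\<gamma> has_vector_derivative \<gamma>1 t) (at t within {l..r})"
    "\<And>t. t \<in> {l..r} \<Longrightarrow> (\<gamma>1 has_vector_derivative \<gamma>2 t) (at t within {l..r})"
    "continuous_on {l..r} \<gamma>2"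
    "\<And>t e. t \<in> {l..r} \<Longrightarrow> dd (0, \<gamma>1 t) (dd (e, 0) C) (x, \<gamma> t) = - (b \<bullet> e)"
    "\<And>t e. t \<in> {l..r} \<Longrightarrow>
      dd (0, \<gamma>1 t) (dd (0, \<gamma>1 t) (dd (e, 0) C)) (x, \<gamma> t) + dd (0, \<gamma>2 t) (dd (e, 0) C) (x, \<gamma> t) = 0"
proof -
  have mem: "(x, \<gamma> t) \<in> W" if "t \<in> {l..r}" for t
    using seg[OF that] x by (auto simp: \<gamma>_def intro!: inW inv_into_into)
  have sub: "closure V \<subseteq> {y. (x, y) \<in> W}" using x inW by auto
  obtain \<gamma>1 \<gamma>2 where
    \<gamma>: "\<And>t. t \<in> {l..r} \<Longrightarrow> (\<gamma> has_vector_derivative \<gamma>1 t) (at t within {l..r})"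
    "\<And>t. t \<in> {l..r} \<Longrightarrow> (\<gamma>1 has_vector_derivative \<gamma>2 t) (at t within {l..r})"
    "continuous_on {l..r} \<gamma>2"
    "\<And>t e. t \<in> {l..r} \<Longrightarrow> dd (\<gamma>1 t) (\<lambda>y. (- Dx c x y) \<bullet> e) (\<gamma> t) = b \<bullet> e"
    "\<And>t e. t \<in> {l..r} \<Longrightarrow>
      dd (\<gamma>1 t) (dd (\<gamma>1 t) (\<lambda>y. (- Dx c x y) \<bullet> e)) (\<gamma> t) + dd (\<gamma>2 t) (\<lambda>y. (- Dx c x y) \<bullet> e) (\<gamma> t) = 0"
    using inverse_curve[OF diffeo_y[OF x] Ck_slice(4)[OF C_smooth(1) W(1)] sub slice_smooth(2) \<open>l < r\<close> seg]
    unfolding \<gamma>_def by blast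
  show ?thesis
  proof (rule that[OF \<gamma>(1-3)])
    fix t e assume t: "t \<in> {l..r}"
    show "dd (0, \<gamma>1 t) (dd (e, 0) C) (x, \<gamma> t) = - (b \<bullet> e)"
      using \<gamma>(4)[OF t, of "- e"] slice_dd_y(1)[OF mem[OF t], of _ "- e"] by simp
    show "dd (0, \<gamma>1 t) (dd (0, \<gamma>1 t) (dd (e, 0) C)) (x, \<gamma> t) + dd (0, \<gamma>2 t) (dd (e, 0) C) (x, \<gamma> t) = 0"
      using \<gamma>(5)[OF t, of "- e"] slice_dd_y[OF mem[OF t], where e = "- e"] by simp
  qed
qed

text \<open>Nondegeneracy of the matrix of mixed second derivatives of the cost: up to sign it is
  the derivative of the coordinate map, which (B1) makes bijective.\<close>

lemma mixed_bij_x: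
  assumes "x \<in> closure U" "y \<in> closure V"
  obtains A where "bij A" "\<And>v e. dd (v, 0) (dd (0, e) C) (x, y) = A v \<bullet> e"
proof -
  obtain f' where f': "((\<lambda>x. - Dy c x y) has_derivative f') (at x)" "bij f'"
    using diffeo_x[OF assms(2)] assms(1) by (auto simp: diffeo_onto_range_def)
  have "dd (v, 0) (dd (0, e) C) (x, y) = f' v \<bullet> (- e)" for v e
  proof -
    have "((\<lambda>x. (- Dy c x y) \<bullet> (- e)) has_derivative (\<lambda>v. f' v \<bullet> (- e))) (at x)"
      by (rule has_derivative_inner_left[OF f'(1)])
    from dd_eqI[OF this, of v] slice_dd_x(1)[OF inW[OF assms], of v "- e"]
    show ?thesis by simp
  qed
  moreover have "bij (\<lambda>v. - f' v)"
    using bij_comp[OF f'(2) bij_uminus] by (simp add: o_def)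
  ultimately show ?thesis using that[of "\<lambda>v. - f' v"] by simp
qed

lemma mixed_bij_y:
  assumes "x \<in> closure U" "y \<in> closure V"
  obtains A where "bij A" "\<And>v e. dd (0, v) (dd (e, 0) C) (x, y) = A v \<bullet> e"
proof -
  obtain f' where f': "((\<lambda>y. - Dx c x y) has_derivative f') (at y)" "bij f'"
    using diffeo_y[OF assms(1)] assms(2) by (auto simp: diffeo_onto_range_def)
  have "dd (0, v) (dd (e, 0) C) (x, y) = f' v \<bullet> (- e)" for v e
  proof -
    have "((\<lambda>y. (- Dx c x y) \<bullet> (- e)) has_derivative (\<lambda>v. f' v \<bullet> (- e))) (at y)"
      by (rule has_derivative_inner_left[OF f'(1)])
    from dd_eqI[OF this, of v] slice_dd_y(1)[OF inW[OF assms], of v "- e"]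
    show ?thesis by simp
  qed
  moreover have "bij (\<lambda>v. - f' v)"
    using bij_comp[OF f'(2) bij_uminus] by (simp add: o_def)
  ultimately show ?thesis using that[of "\<lambda>v. - f' v"] by simp
qed

text \<open>Identifies velocities and accelerations of constructed curves, which are known only
  through the linear equations they satisfy.\<close>

lemma mixed_inj_x:
  assumes "x \<in> closure U" "y \<in> closure V"
    and "\<And>e. dd (v, 0) (dd (0, e) C) (x, y) = dd (w, 0) (dd (0, e) C) (x, y)"
  shows "v = w"
proof -
  obtain A where A: "bij A" "\<And>v e. dd (v, 0) (dd (0, e) C) (x, y) = A v \<bullet> e"
    using mixed_bij_x[OF assms(1,2)] by blast
  have "A v = A w" by (subst vector_eq_rdot[symmetric]) (simp flip: A(2) add: assms(3))
  then show ?thesis using A(1) by (simp add: bij_def inj_eq)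
qed

lemma mixed_inj_y:
  assumes "x \<in> closure U" "y \<in> closure V"
    and "\<And>e. dd (0, v) (dd (e, 0) C) (x, y) = dd (0, w) (dd (e, 0) C) (x, y)"
  shows "v = w"
proof -
  obtain A where A: "bij A" "\<And>v e. dd (0, v) (dd (e, 0) C) (x, y) = A v \<bullet> e"
    using mixed_bij_y[OF assms(1,2)] by blast
  have "A v = A w" by (subst vector_eq_rdot[symmetric]) (simp flip: A(2) add: assms(3))
  then show ?thesis using A(1) by (simp add: bij_def inj_eq)
qed

end

section \<open>The curvature conditions\<close>

text \<open>The scale sits in the direction, so that the parameter always runs over
  \<open>{-1..1}\<close>, as \<open>seg_curves\<close> demands; allowing every smaller scale lets
  two segments share one.\<close>

lemma small_segment:
  fixes p \<beta> :: "'v::real_normed_vector"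
  assumes "open S" "p \<in> S"
  obtains \<epsilon> where "\<epsilon> > 0" "\<And>e t. 0 \<le> e \<Longrightarrow> e \<le> \<epsilon> \<Longrightarrow> t \<in> {-1..1} \<Longrightarrow> p + t *\<^sub>R (e *\<^sub>R \<beta>) \<in> S"
proof -
  obtain d where d: "d > 0" "ball p d \<subseteq> S" using assms openE by blast
  define \<epsilon> where "\<epsilon> = d / (norm \<beta> + 1)"
  have pos: "norm \<beta> + 1 > 0" by (smt (verit) norm_ge_zero)
  show thesis
  proof (rule that)
    show "\<epsilon> > 0" using d pos by (simp add: \<epsilon>_def)
    fix e t :: real assume e: "0 \<le> e" "e \<le> \<epsilon>" and t: "t \<in> {-1..1}"
    have "norm (t *\<^sub>R (e *\<^sub>R \<beta>)) = \<bar>t\<bar> * (e * norm \<beta>)" using e by (simp add: abs_mult)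
    also have "\<dots> \<le> 1 * (e * norm \<beta>)" using t e by (intro mult_right_mono) auto
    also have "\<dots> \<le> \<epsilon> * norm \<beta>" using e by (simp add: mult_right_mono)
    also have "\<dots> < d" using d pos by (simp add: \<epsilon>_def field_simps)
    finally have "p + t *\<^sub>R (e *\<^sub>R \<beta>) \<in> ball p d" by (simp add: dist_norm)
    then show "p + t *\<^sub>R (e *\<^sub>R \<beta>) \<in> S" using d by blast
  qed
qed

context c_domain
begin

text \<open>\<open>deriv\<close> at a point needs its argument on a neighbourhood. So each
  derivative is computed on the open interval before the next is taken, and the one-sided hypotheses
  become two-sided there.\<close>

lemma d_curves:
  fixes x y x1 x2 y1 y2 :: "real \<Rightarrow> 'a"
  assumes x: "\<And>t. t \<in> {-1..1} \<Longrightarrow> (x has_vector_derivative x1 t) (at t within {-1..1})"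
      "\<And>t. t \<in> {-1..1} \<Longrightarrow> (x1 has_vector_derivative x2 t) (at t within {-1..1})"
    and y: "\<And>t. t \<in> {-1..1} \<Longrightarrow> (y has_vector_derivative y1 t) (at t within {-1..1})"
      "\<And>t. t \<in> {-1..1} \<Longrightarrow> (y1 has_vector_derivative y2 t) (at t within {-1..1})"
    and mem: "\<And>s t. s \<in> {-1..1} \<Longrightarrow> t \<in> {-1..1} \<Longrightarrow> (x s, y t) \<in> W"
  defines "F \<equiv> \<lambda>s t. c (x s) (y t)"
  defines "A \<equiv> dd (0, y1 0) (dd (0, y1 0) C)" and "B \<equiv> dd (0, y2 0) C"
  shows "d1 (d2 F) 0 0 = dd (x1 0, 0) (dd (0, y1 0) C) (x 0, y 0)"
    and "d1 (d1 (d2 (d2 F))) 0 0 = dd (x1 0, 0) (dd (x1 0, 0) A) (x 0, y 0) + dd (x2 0, 0) A (x 0, y 0)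
      + (dd (x1 0, 0) (dd (x1 0, 0) B) (x 0, y 0) + dd (x2 0, 0) B (x 0, y 0))"
proof -
  let ?T = "{-1..1::real}" and ?I = "{-1<..<1::real}"
  have at: "at t within ?T = at t" if "t \<in> ?I" for t using that by (simp add: at_within_Icc_at)
  have xp: "((\<lambda>s. (x s, b)) has_vector_derivative (x1 s, 0)) (at s within ?T)"
      "((\<lambda>s. (x1 s, 0::'a)) has_vector_derivative (x2 s, 0)) (at s within ?T)" if "s \<in> ?T" for s b
    by (intro has_vector_derivative_Pair x that has_vector_derivative_const)+
  have yp: "((\<lambda>t. (a, y t)) has_vector_derivative (0, y1 t)) (at t within ?T)"
      "((\<lambda>t. (0::'a, y1 t)) has_vector_derivative (0, y2 t)) (at t within ?T)" if "t \<in> ?T" for t a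
    by (intro has_vector_derivative_Pair y that has_vector_derivative_const)+
  have dt: "d2 F s t = dd (0, y1 t) C (x s, y t)" if s: "s \<in> ?T" and t: "t \<in> ?I" for s t
  proof -
    have t': "t \<in> ?T" using t by auto
    have "((\<lambda>t. C (x s, y t)) has_real_derivative dd (0, y1 t) C (x s, y t)) (at t within ?T)"
      by (rule has_real_derivative_curve[OF C_diff(1)[OF mem[OF s t']] yp(1)[OF t']])
    then show ?thesis
      unfolding d2_def F_def by (intro DERIV_imp_deriv) (simp add: at[OF t])
  qed
  \<comment> \<open>After the two t-derivatives t is frozen at 0, so the directions inside
    \<open>A\<close> and \<open>B\<close> are constants and the s-derivatives act only through the
    curve \<open>x\<close>.\<close>
  have dtt: "d2 (d2 F) s 0 = A (x s, y 0) + B (x s, y 0)" if s: "s \<in> ?T" for s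
  proof -
    have "((\<lambda>t. dd (0, y1 t) C (x s, y t)) has_real_derivative
        dd (0, y1 0) (dd (0, y1 0) C) (x s, y 0) + dd (0, y2 0) C (x s, y 0)) (at 0 within ?T)"
      by (rule has_real_derivative_curve2[OF C_smooth(1) W(1) mem[OF s] _ yp]) auto
    then have "((\<lambda>t. dd (0, y1 t) C (x s, y t)) has_real_derivative A (x s, y 0) + B (x s, y 0)) (at 0)"
      by (simp add: at A_def B_def)
    then have "((\<lambda>t. d2 F s t) has_real_derivative A (x s, y 0) + B (x s, y 0)) (at 0)"
      by (rule has_field_derivative_transform_within_open[where S = ?I]) (auto simp: dt[OF s])
    then show ?thesis unfolding d2_def[of "d2 F"] by (rule DERIV_imp_deriv)
  qed
  have x0: "0 \<in> ?T" "0 \<in> ?I" by auto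
  show "d1 (d2 F) 0 0 = dd (x1 0, 0) (dd (0, y1 0) C) (x 0, y 0)"
  proof -
    have "((\<lambda>s. dd (0, y1 0) C (x s, y 0)) has_real_derivative dd (x1 0, 0) (dd (0, y1 0) C) (x 0, y 0)) (at 0 within ?T)"
      by (rule has_real_derivative_curve[OF C_diff(2)[OF mem[OF x0(1) x0(1)]] xp(1)[OF x0(1)]])
    then have "((\<lambda>s. dd (0, y1 0) C (x s, y 0)) has_real_derivative dd (x1 0, 0) (dd (0, y1 0) C) (x 0, y 0)) (at 0)"
      by (simp add: at)
    then have "((\<lambda>s. d2 F s 0) has_real_derivative dd (x1 0, 0) (dd (0, y1 0) C) (x 0, y 0)) (at 0)"
      by (rule has_field_derivative_transform_within_open[where S = ?I]) (auto simp: dt)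
    then show ?thesis unfolding d1_def by (rule DERIV_imp_deriv)
  qed
  have AB: "Ck 2 A W" "Ck 2 B W" unfolding A_def B_def by (rule C_smooth)+
  have ds: "d1 (d2 (d2 F)) s 0 = dd (x1 s, 0) A (x s, y 0) + dd (x1 s, 0) B (x s, y 0)" if s: "s \<in> ?I" for s
  proof -
    have s': "s \<in> ?T" using s by auto
    have "((\<lambda>s. A (x s, y 0) + B (x s, y 0)) has_real_derivative
        dd (x1 s, 0) A (x s, y 0) + dd (x1 s, 0) B (x s, y 0)) (at s within ?T)"
      by (intro DERIV_add has_real_derivative_curve Ck_2D(1)[OF AB(1) mem[OF s' x0(1)]]
          Ck_2D(1)[OF AB(2) mem[OF s' x0(1)]] xp(1)[OF s'])
    then have "((\<lambda>s. A (x s, y 0) + B (x s, y 0)) has_real_derivative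
        dd (x1 s, 0) A (x s, y 0) + dd (x1 s, 0) B (x s, y 0)) (at s)"
      unfolding at[OF s] .
    then have "((\<lambda>s. d2 (d2 F) s 0) has_real_derivative
        dd (x1 s, 0) A (x s, y 0) + dd (x1 s, 0) B (x s, y 0)) (at s)"
      by (rule has_field_derivative_transform_within_open[where S = ?I]) (use s in \<open>auto simp: dtt\<close>)
    then show ?thesis unfolding d1_def by (rule DERIV_imp_deriv)
  qed
  have "((\<lambda>s. dd (x1 s, 0) A (x s, y 0) + dd (x1 s, 0) B (x s, y 0)) has_real_derivative
      dd (x1 0, 0) (dd (x1 0, 0) A) (x 0, y 0) + dd (x2 0, 0) A (x 0, y 0)
      + (dd (x1 0, 0) (dd (x1 0, 0) B) (x 0, y 0) + dd (x2 0, 0) B (x 0, y 0))) (at 0 within ?T)"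
    by (rule DERIV_add; rule has_real_derivative_curve2[OF _ W(1) mem _ xp]) (use AB in auto)
  then have "((\<lambda>s. dd (x1 s, 0) A (x s, y 0) + dd (x1 s, 0) B (x s, y 0)) has_real_derivative
      dd (x1 0, 0) (dd (x1 0, 0) A) (x 0, y 0) + dd (x2 0, 0) A (x 0, y 0)
      + (dd (x1 0, 0) (dd (x1 0, 0) B) (x 0, y 0) + dd (x2 0, 0) B (x 0, y 0))) (at 0)"
    unfolding at[OF x0(2)] .
  then have "((\<lambda>s. d1 (d2 (d2 F)) s 0) has_real_derivative
      dd (x1 0, 0) (dd (x1 0, 0) A) (x 0, y 0) + dd (x2 0, 0) A (x 0, y 0)
      + (dd (x1 0, 0) (dd (x1 0, 0) B) (x 0, y 0) + dd (x2 0, 0) B (x 0, y 0))) (at 0)"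
    by (rule has_field_derivative_transform_within_open[where S = ?I]) (auto simp: ds)
  then show "d1 (d1 (d2 (d2 F))) 0 0 = dd (x1 0, 0) (dd (x1 0, 0) A) (x 0, y 0) + dd (x2 0, 0) A (x 0, y 0)
      + (dd (x1 0, 0) (dd (x1 0, 0) B) (x 0, y 0) + dd (x2 0, 0) B (x 0, y 0))"
    unfolding d1_def[of "d1 (d2 (d2 F))"] by (rule DERIV_imp_deriv)
qed

text \<open>
The expression involves a curve \<open>x(s)\<close> only through its velocity \<open>\<xi>\<close>: by the equation for \<open>\<eta>, \<omega>\<close> the terms with \<open>x''(0)\<close>
cancel. So \<open>x(s)\<close> may be chosen as a segment with respect to \<open>y0\<close>, short enough to stay in \<open>U\<close>.
\<close>
lemma cross_derivative_nonpos:
  assumes xU: "x0 \<in> U" and yV: "y0 \<in> V"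
    and y2: "\<And>e. dd (0, \<eta>) (dd (0, \<eta>) (dd (e, 0) C)) (x0, y0) + dd (0, \<omega>) (dd (e, 0) C) (x0, y0) = 0"
    and curv: "A3w U V c \<and> dd (\<xi>, 0) (dd (0, \<eta>) C) (x0, y0) = 0 \<or> B3 U V c"
  shows "dd (0, \<eta>) (dd (0, \<eta>) (dd (\<xi>, 0) (dd (\<xi>, 0) C))) (x0, y0)
    + dd (0, \<omega>) (dd (\<xi>, 0) (dd (\<xi>, 0) C)) (x0, y0) \<le> 0"
proof -
  let ?T = "{-1..1::real}"
  let ?\<phi> = "\<lambda>x. - Dy c x y0" and ?\<psi> = "\<lambda>y. - Dx c x0 y"
  define z0 where "z0 = (x0, y0)"
  have x0: "x0 \<in> closure U" and y0: "y0 \<in> closure V"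
    using xU yV closure_subset by auto
  have zW: "z0 \<in> W" unfolding z0_def by (rule inW[OF x0 y0])
  have bxi: "- ((\<Sum>b\<in>Basis. - dd (\<xi>, 0) (dd (0, b) C) z0 *\<^sub>R b) \<bullet> e) = dd (\<xi>, 0) (dd (0, e) C) z0" for e
  proof -
    obtain M where M: "\<And>v e. dd (v, 0) (dd (0, e) C) (x0, y0) = M v \<bullet> e"
      using mixed_bij_x[OF x0 y0] by metis
    show ?thesis unfolding z0_def M by (simp add: sum_negf euclidean_representation)
  qed
  have beta: "- ((\<Sum>b\<in>Basis. - dd (0, \<eta>) (dd (b, 0) C) z0 *\<^sub>R b) \<bullet> e) = dd (0, \<eta>) (dd (e, 0) C) z0" for e
  proof -
    obtain M where M: "\<And>v e. dd (0, v) (dd (e, 0) C) (x0, y0) = M v \<bullet> e"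
      using mixed_bij_y[OF x0 y0] by metis
    show ?thesis unfolding z0_def M by (simp add: sum_negf euclidean_representation)
  qed
  \<comment> \<open>\<open>\<beta>\<close> and \<open>\<alpha>\<close> are the velocities
    \<open>\<xi>\<close> and \<open>\<eta>\<close> expressed in the cost coordinates at
    \<open>y0\<close> and \<open>x0\<close>: the straight directions whose preimages leave with the
    prescribed velocities.\<close>
  define \<beta> where "\<beta> = (\<Sum>b\<in>Basis. - dd (\<xi>, 0) (dd (0, b) C) z0 *\<^sub>R b)"
  define \<alpha> where "\<alpha> = (\<Sum>b\<in>Basis. - dd (0, \<eta>) (dd (b, 0) C) z0 *\<^sub>R b)"
  obtain e1 where e1: "e1 > 0" "\<And>e t. 0 \<le> e \<Longrightarrow> e \<le> e1 \<Longrightarrow> t \<in> ?T \<Longrightarrow> ?\<phi> x0 + t *\<^sub>R (e *\<^sub>R \<beta>) \<in> ?\<phi> ` U"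
    by (rule small_segment[OF diffeo_onto_range_closure(2)[OF diffeo_x[OF y0] U] imageI[OF xU]]) blast
  obtain e2 where e2: "e2 > 0" "\<And>e t. 0 \<le> e \<Longrightarrow> e \<le> e2 \<Longrightarrow> t \<in> ?T \<Longrightarrow> ?\<psi> y0 + t *\<^sub>R (e *\<^sub>R \<alpha>) \<in> ?\<psi> ` V"
    by (rule small_segment[OF diffeo_onto_range_closure(2)[OF diffeo_y[OF x0] V] imageI[OF yV]]) blast
  \<comment> \<open>One scale for both curves. Velocities become \<epsilon> times
    \<open>\<xi>\<close> and \<open>\<eta>\<close>, the y-acceleration is multiplied by
    \<open>\<epsilon>\<^sup>2\<close>, and the whole expression by
    \<open>\<epsilon>\<^sup>2 * \<epsilon>\<^sup>2\<close>, which is divided out at the end.\<close>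
  define \<epsilon> where "\<epsilon> = min e1 e2"
  have eps: "\<epsilon> > 0" "\<epsilon> \<le> e1" "\<epsilon> \<le> e2" using e1 e2 by (auto simp: \<epsilon>_def)
  have segx: "?\<phi> x0 + t *\<^sub>R (\<epsilon> *\<^sub>R \<beta>) \<in> ?\<phi> ` closure U" if "t \<in> ?T" for t
    using e1(2)[of \<epsilon> t] eps that closure_subset[of U] by auto
  have segy: "?\<psi> y0 + t *\<^sub>R (\<epsilon> *\<^sub>R \<alpha>) \<in> ?\<psi> ` closure V" if "t \<in> ?T" for t
    using e2(2)[of \<epsilon> t] eps that closure_subset[of V] by auto
  define x where "x t = inv_into (closure U) ?\<phi> (?\<phi> x0 + t *\<^sub>R (\<epsilon> *\<^sub>R \<beta>))" for t
  define y where "y t = inv_into (closure V) ?\<psi> (?\<psi> y0 + t *\<^sub>R (\<epsilon> *\<^sub>R \<alpha>))" for t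
  have injx: "inj_on ?\<phi> (closure U)" and injy: "inj_on ?\<psi> (closure V)"
    using diffeo_x[OF y0] diffeo_y[OF x0] by (auto simp: diffeo_onto_range_def)
  have x_0: "x 0 = x0" and y_0: "y 0 = y0"
    using inv_into_f_f[OF injx x0] inv_into_f_f[OF injy y0] by (simp_all add: x_def y_def)
  have x_in: "x t \<in> closure U" and x_eq: "?\<phi> (x t) = ?\<phi> x0 + t *\<^sub>R (\<epsilon> *\<^sub>R \<beta>)" if "t \<in> ?T" for t
    using segx[OF that] unfolding x_def by (rule inv_into_into, rule f_inv_into_f)
  have y_in: "y t \<in> closure V" and y_eq: "?\<psi> (y t) = ?\<psi> y0 + t *\<^sub>R (\<epsilon> *\<^sub>R \<alpha>)" if "t \<in> ?T" for t
    using segy[OF that] unfolding y_def by (rule inv_into_into, rule f_inv_into_f)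
  have seg: "seg_curves U V c x y"
    unfolding seg_curves_def
  proof (intro conjI ballI exI)
    fix t :: real assume t: "t \<in> ?T"
    have "Dy c (x t) y0 = Dy c x0 y0 + t *\<^sub>R (- (\<epsilon> *\<^sub>R \<beta>))"
      using x_eq[OF t] by (metis add.inverse_inverse minus_add_distrib scaleR_minus_right)
    moreover have "Dx c x0 (y t) = Dx c x0 y0 + t *\<^sub>R (- (\<epsilon> *\<^sub>R \<alpha>))"
      using y_eq[OF t] by (metis add.inverse_inverse minus_add_distrib scaleR_minus_right)
    ultimately show "(Dy c (x t) (y 0), Dx c (x 0) (y t)) =
        (Dy c x0 y0, Dx c x0 y0) + t *\<^sub>R (- (\<epsilon> *\<^sub>R \<beta>), - (\<epsilon> *\<^sub>R \<alpha>))"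
      by (simp add: x_0 y_0)
  qed (use x_in y_in in auto)
  have m11: "- 1 < (1::real)" by simp
  obtain x1 x2 where x12:
    "\<And>t. t \<in> ?T \<Longrightarrow> (x has_vector_derivative x1 t) (at t within ?T)"
    "\<And>t. t \<in> ?T \<Longrightarrow> (x1 has_vector_derivative x2 t) (at t within ?T)"
    "\<And>t e. t \<in> ?T \<Longrightarrow> dd (x1 t, 0) (dd (0, e) C) (x t, y0) = - (\<epsilon> *\<^sub>R \<beta> \<bullet> e)"
    by (rule x_segment[OF y0 m11 segx, unfolded x_def[symmetric]], assumption) (rule that; assumption)
  obtain y1 y2 where y12:
    "\<And>t. t \<in> ?T \<Longrightarrow> (y has_vector_derivative y1 t) (at t within ?T)"
    "\<And>t. t \<in> ?T \<Longrightarrow> (y1 has_vector_derivative y2 t) (at t within ?T)"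
    "\<And>t e. t \<in> ?T \<Longrightarrow> dd (0, y1 t) (dd (e, 0) C) (x0, y t) = - (\<epsilon> *\<^sub>R \<alpha> \<bullet> e)"
    "\<And>t e. t \<in> ?T \<Longrightarrow> dd (0, y1 t) (dd (0, y1 t) (dd (e, 0) C)) (x0, y t) + dd (0, y2 t) (dd (e, 0) C) (x0, y t) = 0"
    by (rule y_segment[OF x0 m11 segy, unfolded y_def[symmetric]], assumption) (rule that; assumption)
  have T0: "0 \<in> ?T" by auto
  have sc1: "(r *\<^sub>R v, 0) = r *\<^sub>R (v, 0 :: 'a)" and sc2: "(0, r *\<^sub>R v) = r *\<^sub>R (0 :: 'a, v)" for r and v :: 'a
    by simp_all
  have x1: "x1 0 = \<epsilon> *\<^sub>R \<xi>"
  proof (rule mixed_inj_x[OF x0 y0])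
    fix e
    have "dd (x1 0, 0) (dd (0, e) C) (x0, y0) = \<epsilon> * dd (\<xi>, 0) (dd (0, e) C) z0"
      using x12(3)[OF T0, of e] bxi[of e] unfolding x_0 \<beta>_def[symmetric] by (simp flip: mult_minus_right)
    then show "dd (x1 0, 0) (dd (0, e) C) (x0, y0) = dd (\<epsilon> *\<^sub>R \<xi>, 0) (dd (0, e) C) (x0, y0)"
      unfolding sc1 dd_scale[OF C_diff(2)[OF zW], unfolded z0_def] z0_def .
  qed
  have y1: "y1 0 = \<epsilon> *\<^sub>R \<eta>"
  proof (rule mixed_inj_y[OF x0 y0])
    fix e
    have "dd (0, y1 0) (dd (e, 0) C) (x0, y0) = \<epsilon> * dd (0, \<eta>) (dd (e, 0) C) z0"
      using y12(3)[OF T0, of e] beta[of e] unfolding y_0 \<alpha>_def[symmetric] by (simp flip: mult_minus_right)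
    then show "dd (0, y1 0) (dd (e, 0) C) (x0, y0) = dd (0, \<epsilon> *\<^sub>R \<eta>) (dd (e, 0) C) (x0, y0)"
      unfolding sc2 dd_scale[OF C_diff(2)[OF zW], unfolded z0_def] z0_def .
  qed
  \<comment> \<open>Both sides solve the same nondegenerate linear system: the term quadratic in the
    velocity scales by \<open>\<epsilon>\<^sup>2\<close>, hence so does the acceleration.\<close>
  have y2': "y2 0 = \<epsilon>\<^sup>2 *\<^sub>R \<omega>"
  proof (rule mixed_inj_y[OF x0 y0])
    fix e
    have "dd (0, y1 0) (dd (0, y1 0) (dd (e, 0) C)) z0 = \<epsilon>\<^sup>2 * dd (0, \<eta>) (dd (0, \<eta>) (dd (e, 0) C)) z0"
      unfolding y1 unfolding sc2 by (rule dd2_scale[OF C_smooth(4) W(1) zW])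
    moreover have "dd (0, \<epsilon>\<^sup>2 *\<^sub>R \<omega>) (dd (e, 0) C) z0 = \<epsilon>\<^sup>2 * dd (0, \<omega>) (dd (e, 0) C) z0"
      unfolding sc2 by (rule dd_scale[OF C_diff(2)[OF zW]])
    moreover have "dd (0, \<eta>) (dd (0, \<eta>) (dd (e, 0) C)) z0 = - dd (0, \<omega>) (dd (e, 0) C) z0"
      using y2[of e] unfolding z0_def[symmetric] by linarith
    then have "\<epsilon>\<^sup>2 * dd (0, \<eta>) (dd (0, \<eta>) (dd (e, 0) C)) z0 = - (\<epsilon>\<^sup>2 * dd (0, \<omega>) (dd (e, 0) C) z0)"
      by simp
    ultimately show "dd (0, y2 0) (dd (e, 0) C) (x0, y0) = dd (0, \<epsilon>\<^sup>2 *\<^sub>R \<omega>) (dd (e, 0) C) (x0, y0)"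
      using y12(4)[OF T0, of e] unfolding y_0 z0_def[symmetric] by linarith
  qed
  let ?\<xi> = "(\<epsilon> *\<^sub>R \<xi>, 0 :: 'a)" and ?\<eta> = "(0 :: 'a, \<epsilon> *\<^sub>R \<eta>)" and ?\<omega> = "(0 :: 'a, \<epsilon>\<^sup>2 *\<^sub>R \<omega>)" and ?\<zeta> = "(x2 0, 0 :: 'a)"
  have mem: "(x s, y t) \<in> W" if "s \<in> ?T" "t \<in> ?T" for s t
    using inW[OF x_in[OF that(1)] y_in[OF that(2)]] .
  note ds = d_curves[OF x12(1,2) y12(1,2) mem, unfolded x_0 y_0 x1 y1 y2', folded z0_def]
  have "- d1 (d1 (d2 (d2 (\<lambda>s t. c (x s) (y t))))) 0 0 \<ge> 0"
    using curv
  proof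
    assume A: "A3w U V c \<and> dd (\<xi>, 0) (dd (0, \<eta>) C) (x0, y0) = 0"
    have "dd ?\<xi> (dd ?\<eta> C) z0 = \<epsilon> * dd (\<xi>, 0) (dd ?\<eta> C) z0"
      unfolding sc1 by (rule dd_scale[OF C_diff(2)[OF zW]])
    also have "dd (\<xi>, 0) (dd ?\<eta> C) z0 = dd ?\<eta> (dd (\<xi>, 0) C) z0"
      by (rule dd_commute[OF C_smooth(1) W(1) zW])
    also have "\<dots> = \<epsilon> * dd (0, \<eta>) (dd (\<xi>, 0) C) z0"
      unfolding sc2 by (rule dd_scale[OF C_diff(2)[OF zW]])
    also have "dd (0, \<eta>) (dd (\<xi>, 0) C) z0 = dd (\<xi>, 0) (dd (0, \<eta>) C) z0"
      by (rule dd_commute[OF C_smooth(1) W(1) zW])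
    finally have "d1 (d2 (\<lambda>s t. c (x s) (y t))) 0 0 = 0"
      using A ds(1) by (simp add: z0_def)
    then show ?thesis using A seg by (auto simp: A3w_def)
  next
    assume "B3 U V c"
    then show ?thesis using seg by (auto simp: B3_def)
  qed
  then have le: "dd ?\<xi> (dd ?\<xi> (dd ?\<eta> (dd ?\<eta> C))) z0 + dd ?\<zeta> (dd ?\<eta> (dd ?\<eta> C)) z0
      + (dd ?\<xi> (dd ?\<xi> (dd ?\<omega> C)) z0 + dd ?\<zeta> (dd ?\<omega> C) z0) \<le> 0"
    using ds(2) by linarith
  have "dd ?\<zeta> (dd ?\<eta> (dd ?\<eta> C)) z0 = dd ?\<eta> (dd ?\<eta> (dd ?\<zeta> C)) z0"
    by (rule dd_rotate3[OF C_smooth(2) W(1) zW, symmetric])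
  moreover have "dd ?\<zeta> (dd ?\<omega> C) z0 = dd ?\<omega> (dd ?\<zeta> C) z0"
    by (rule dd_commute[OF C_smooth(1) W(1) zW])
  moreover have "dd ?\<eta> (dd ?\<eta> (dd ?\<zeta> C)) z0 + dd ?\<omega> (dd ?\<zeta> C) z0 = 0"
    using y12(4)[OF T0, of "x2 0"] by (simp add: y1 y2' y_0 z0_def)
  ultimately have le2: "dd ?\<xi> (dd ?\<xi> (dd ?\<eta> (dd ?\<eta> C))) z0 + dd ?\<xi> (dd ?\<xi> (dd ?\<omega> C)) z0 \<le> 0"
    using le by linarith
  have sq: "dd ?\<xi> (dd ?\<xi> C) z = \<epsilon>\<^sup>2 * dd (\<xi>, 0) (dd (\<xi>, 0) C) z" if "z \<in> W" for z
    unfolding sc1 by (rule dd2_scale[OF C_smooth(1) W(1) that])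
  \<comment> \<open>The x-directions are moved innermost, the order used in the conclusion, and the
    powers of \<epsilon> are extracted on the way.\<close>
  have "dd ?\<xi> (dd ?\<xi> (dd ?\<eta> (dd ?\<eta> C))) z0 = dd ?\<eta> (dd ?\<eta> (dd ?\<xi> (dd ?\<xi> C))) z0"
    by (rule dd_swap_pairs[OF C4 W(1) zW])
  also have "\<dots> = \<epsilon>\<^sup>2 * dd ?\<eta> (dd ?\<eta> (dd (\<xi>, 0) (dd (\<xi>, 0) C))) z0"
    by (rule dd2_cmult_on[OF C_smooth(5) W(1) zW sq])
  also have "\<dots> = \<epsilon>\<^sup>2 * (\<epsilon>\<^sup>2 * dd (0, \<eta>) (dd (0, \<eta>) (dd (\<xi>, 0) (dd (\<xi>, 0) C))) z0)"
    unfolding sc2 by (simp only: dd2_scale[OF C_smooth(5) W(1) zW])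
  finally have t1: "dd ?\<xi> (dd ?\<xi> (dd ?\<eta> (dd ?\<eta> C))) z0 =
    \<epsilon>\<^sup>2 * (\<epsilon>\<^sup>2 * dd (0, \<eta>) (dd (0, \<eta>) (dd (\<xi>, 0) (dd (\<xi>, 0) C))) z0)" .
  have "dd ?\<xi> (dd ?\<xi> (dd ?\<omega> C)) z0 = dd ?\<omega> (dd ?\<xi> (dd ?\<xi> C)) z0"
    by (rule dd_rotate3[OF C_smooth(2) W(1) zW])
  also have "\<dots> = \<epsilon>\<^sup>2 * dd ?\<omega> (dd (\<xi>, 0) (dd (\<xi>, 0) C)) z0"
    by (rule dd_cmult_on[OF Ck_mono[OF C_smooth(5)] W(1) zW sq]) simp
  also have "dd ?\<omega> (dd (\<xi>, 0) (dd (\<xi>, 0) C)) z0 = \<epsilon>\<^sup>2 * dd (0, \<omega>) (dd (\<xi>, 0) (dd (\<xi>, 0) C)) z0"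
    unfolding sc2 by (rule dd_scale[OF C_diff(3)[OF zW]])
  finally have "\<epsilon>\<^sup>2 * (\<epsilon>\<^sup>2 * (dd (0, \<eta>) (dd (0, \<eta>) (dd (\<xi>, 0) (dd (\<xi>, 0) C))) z0
      + dd (0, \<omega>) (dd (\<xi>, 0) (dd (\<xi>, 0) C)) z0)) \<le> 0"
    using le2 t1 by (simp only: distrib_left)
  then show ?thesis
    using eps(1) unfolding z0_def by (simp add: mult_le_0_iff)
qed

end

section \<open>Convexity along segments\<close>

text \<open>The sign of \<open>g2\<close> is required only inside the interval because the curve to
  which this is applied may start on the boundary of \<open>V\<close>; at 0 the sign of
  \<open>g1\<close> replaces it.\<close>

lemma le_endpoint_if_second_derivative_nonneg:
  fixes g g1 g2 :: "real \<Rightarrow> real"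
  assumes g: "\<And>t. t \<in> {0..1} \<Longrightarrow> (g has_real_derivative g1 t) (at t within {0..1})"
    and g1: "\<And>t. t \<in> {0..1} \<Longrightarrow> (g1 has_real_derivative g2 t) (at t within {0..1})"
    and g2: "\<And>t. 0 < t \<Longrightarrow> t < 1 \<Longrightarrow> g2 t \<ge> 0" and "g1 0 \<ge> 0"
  shows "g 0 \<le> g 1"
proof -
  have cg: "continuous_on {0..1} g" and cg1: "continuous_on {0..1} g1"
    using g g1 DERIV_continuous_on by blast+
  have at: "at t within {0..1} = at t" if "0 < t" "t < 1" for t :: real
    using that by (simp add: at_within_Icc_at)
  have pos: "g1 t \<ge> 0" if t: "0 < t" "t < 1" for t
  proof -
    have "\<exists>l z. 0 < z \<and> z < t \<and> DERIV g1 z :> l \<and> g1 t - g1 0 = (t - 0) * l"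
    proof (rule MVT[OF t(1)])
      show "continuous_on {0..t} g1" using cg1 by (rule continuous_on_subset) (use t in auto)
      show "g1 differentiable at x" if "0 < x" "x < t" for x
        using g1[of x] at[of x] that t by (auto simp: real_differentiable_def)
    qed
    then obtain l z where z: "0 < z" "z < t" "DERIV g1 z :> l" "g1 t - g1 0 = t * l" by auto
    have "DERIV g1 z :> g2 z" using g1[of z] at[of z] z t by auto
    with z(3) have "l = g2 z" by (rule DERIV_unique)
    then have "t * l \<ge> 0" using g2[of z] z t by simp
    then show ?thesis using z(4) assms(4) by linarith
  qed
  have "\<exists>l z. 0 < z \<and> z < 1 \<and> DERIV g z :> l \<and> g 1 - g 0 = (1 - 0) * l"
  proof (rule MVT)
    show "g differentiable at x" if "0 < x" "x < 1" for x
      using g[of x] at[of x] that by (auto simp: real_differentiable_def)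
  qed (use cg in auto)
  then obtain l z where z: "0 < z" "z < 1" "DERIV g z :> l" "g 1 - g 0 = l" by auto
  have "DERIV g z :> g1 z" using g[of z] at[of z] z by auto
  with z(3) have "l = g1 z" by (rule DERIV_unique)
  then show ?thesis using pos[of z] z by simp
qed

text \<open>A value above both end values forces \<open>f1\<close> to be positive at some
  \<open>a\<close> and negative at some later \<open>b\<close>. At the first zero \<open>t\<close>
  after \<open>a\<close>, the local bound contradicts the positivity just before. Hence \<delta> and
  \<open>L\<close> may depend on the critical point, and only points with \<open>f1 s > 0\<close>
  matter.\<close>

lemma quasiconvex_if_second_derivative_bound:
  fixes f f1 f2 :: "real \<Rightarrow> real"
  assumes f: "\<And>t. t \<in> {0..1} \<Longrightarrow> (f has_real_derivative f1 t) (at t within {0..1})"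
    and f1: "\<And>t. t \<in> {0..1} \<Longrightarrow> (f1 has_real_derivative f2 t) (at t within {0..1})"
    and crit: "\<And>t. 0 < t \<Longrightarrow> t < 1 \<Longrightarrow> f1 t = 0 \<Longrightarrow>
      \<exists>\<delta>>0. \<exists>L. \<forall>s\<in>{0<..<1}. \<bar>s - t\<bar> < \<delta> \<longrightarrow> f1 s > 0 \<longrightarrow> f2 s \<ge> - L * f1 s"
    and s: "s \<in> {0..1}"
  shows "f s \<le> max (f 0) (f 1)"
proof (rule ccontr)
  assume "\<not> ?thesis"
  then have fs: "f s > f 0" "f s > f 1" by auto
  then have s01: "0 < s" "s < 1" using s by (auto simp: order_less_le)
  have cf: "continuous_on {0..1} f" and cf1: "continuous_on {0..1} f1"
    using f f1 DERIV_continuous_on by blast+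
  have at: "at t within {0..1} = at t" if "0 < t" "t < 1" for t :: real
    using that by (simp add: at_within_Icc_at)
  have mvt: "\<exists>z. x < z \<and> z < y \<and> f y - f x = (y - x) * f1 z" if xy: "0 \<le> x" "x < y" "y \<le> 1" for x y
  proof -
    have "\<exists>l z. x < z \<and> z < y \<and> DERIV f z :> l \<and> f y - f x = (y - x) * l"
    proof (rule MVT[OF xy(2)])
      show "continuous_on {x..y} f" using cf by (rule continuous_on_subset) (use xy in auto)
      show "f differentiable at z" if "x < z" "z < y" for z
        using f[of z] at[of z] that xy by (auto simp: real_differentiable_def)
    qed
    then obtain l z where z: "x < z" "z < y" "DERIV f z :> l" "f y - f x = (y - x) * l" by auto
    have "DERIV f z :> f1 z" using f[of z] at[of z] z xy by auto
    with z(3) have "l = f1 z" by (rule DERIV_unique)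
    then show ?thesis using z by auto
  qed
  obtain a where a: "0 < a" "a < s" "f s - f 0 = (s - 0) * f1 a"
    using mvt[of 0 s] s01 by auto
  obtain b where b: "s < b" "b < 1" "f 1 - f s = (1 - s) * f1 b"
    using mvt[of s 1] s01 by auto
  have "s * f1 a > 0" using a(3) fs(1) by simp
  then have fa: "f1 a > 0" using s01 by (simp add: zero_less_mult_iff)
  have "(1 - s) * f1 b < 0" using b(3) fs(2) by linarith
  then have fb: "f1 b < 0" using s01 by (simp add: mult_less_0_iff)
  \<comment> \<open>The infimum of \<open>S\<close> is the first point after \<open>a\<close> where
    \<open>f1\<close> is no longer positive; the intermediate value theorem shows that
    \<open>f1\<close> vanishes there.\<close>
  define S where "S = {t \<in> {a..b}. f1 t \<le> 0}"
  have c1: "continuous_on {a..b} f1" using cf1 by (rule continuous_on_subset) (use a b in auto)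
  have "closed S"
    unfolding S_def using continuous_closed_preimage[OF c1 closed_atLeastAtMost closed_atMost[of 0]]
    by (simp add: vimage_def Int_def conj_commute)
  moreover have "b \<in> S" using a b fb by (auto simp: S_def)
  moreover have "bdd_below S" by (rule bdd_belowI[of _ a]) (auto simp: S_def)
  ultimately have tS: "Inf S \<in> S" by (intro closed_contains_Inf) auto
  define t where "t = Inf S"
  have t: "a \<le> t" "t \<le> b" "f1 t \<le> 0" using tS by (auto simp: t_def S_def)
  have at': "a < t" using t fa by (auto simp: order_less_le)
  have before: "f1 u > 0" if "a \<le> u" "u < t" for u
  proof (rule ccontr)
    assume "\<not> ?thesis"
    then have "u \<in> S" using that t by (auto simp: S_def)
    then have "t \<le> u" unfolding t_def by (rule cInf_lower) (rule \<open>bdd_below S\<close>)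
    then show False using that by simp
  qed
  have ft: "f1 t = 0"
  proof (rule ccontr)
    assume "f1 t \<noteq> 0"
    then have "f1 t < 0" using t by simp
    have "\<exists>x\<ge>a. x \<le> t \<and> f1 x = 0"
      by (rule IVT2') (use t at' fa \<open>f1 t < 0\<close> in \<open>auto intro: continuous_on_subset[OF c1]\<close>)
    then obtain x where x: "a \<le> x" "x \<le> t" "f1 x = 0" by auto
    with \<open>f1 t < 0\<close> have "x < t" by (auto simp: order_less_le)
    with before[of x] x show False by simp
  qed
  obtain \<delta> L where \<delta>: "\<delta> > 0" "\<And>s. s \<in> {0<..<1} \<Longrightarrow> \<bar>s - t\<bar> < \<delta> \<Longrightarrow> f1 s > 0 \<Longrightarrow> f2 s \<ge> - L * f1 s"
  proof -
    have "0 < t" "t < 1" using a b at' t by auto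
    from crit[OF this ft] show ?thesis using that by blast
  qed
  define u where "u = max a (t - \<delta> / 2)"
  have u: "a \<le> u" "u < t" "t - u < \<delta>" using at' \<delta>(1) by (auto simp: u_def)
  \<comment> \<open>Integrating factor: the bound on \<open>f2\<close> says that \<open>?h\<close>
    has nonnegative derivative on the interval from \<open>u\<close> to \<open>t\<close>, so a
    positive value at \<open>u\<close> cannot decrease to 0.\<close>
  let ?h = "\<lambda>s. exp (L * s) * f1 s"
  have z01: "0 < z" "z < 1" if "u < z" "z < t" for z using that u a b t by auto
  have dh: "DERIV ?h z :> exp (L * z) * (f2 z + L * f1 z)" if "u < z" "z < t" for z
  proof -
    have f1z: "DERIV f1 z :> f2 z" using f1[of z] at[OF z01[OF that]] z01[OF that] by auto
    show ?thesis by (rule derivative_eq_intros f1z refl | simp add: algebra_simps)+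
  qed
  have "\<exists>l z. u < z \<and> z < t \<and> DERIV ?h z :> l \<and> ?h t - ?h u = (t - u) * l"
  proof (rule MVT[OF u(2)])
    show "continuous_on {u..t} ?h"
      by (intro continuous_intros continuous_on_subset[OF c1]) (use u t in auto)
    show "?h differentiable at z" if "u < z" "z < t" for z
      using dh[OF that] by (auto simp: real_differentiable_def)
  qed
  then obtain l z where z: "u < z" "z < t" "DERIV ?h z :> l" "?h t - ?h u = (t - u) * l" by blast
  have "l = exp (L * z) * (f2 z + L * f1 z)" by (rule DERIV_unique[OF z(3) dh[OF z(1,2)]])
  moreover have "f2 z + L * f1 z \<ge> 0"
    using \<delta>(2)[of z] before[of z] z z01[OF z(1,2)] u by auto
  ultimately have "l \<ge> 0" by simp
  then have "?h t - ?h u \<ge> 0" using z(4) u(2) by simp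
  moreover have "?h u > 0" using before[of u] u by simp
  ultimately show False using ft by simp
qed

section \<open>Comparison of second derivatives and perturbation of the target point\<close>

context c_domain
begin

text \<open>The x-curve enters only through its velocity \<open>\<xi>\<close> and acceleration
  \<open>\<zeta>\<close> at one point; \<open>zeta\<close> records that it is a segment for
  \<open>yt\<close>, which makes the initial slope in t vanish.\<close>

lemma second_derivative_nonneg:
  assumes xU: "x0 \<in> U" and yV: "y \<in> V" and yt: "yt \<in> closure V"
    and zeta: "\<And>e. dd (\<xi>, 0) (dd (\<xi>, 0) (dd (0, e) C)) (x0, yt) + dd (\<zeta>, 0) (dd (0, e) C) (x0, yt) = 0"
    and curv: "A3w U V c \<and> dd (\<xi>, 0) C (x0, y) = dd (\<xi>, 0) C (x0, yt) \<or> B3 U V c"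
  shows "dd (\<xi>, 0) (dd (\<xi>, 0) C) (x0, y) + dd (\<zeta>, 0) C (x0, y)
    \<le> dd (\<xi>, 0) (dd (\<xi>, 0) C) (x0, yt) + dd (\<zeta>, 0) C (x0, yt)"
proof -
  let ?T = "{0..1::real}" and ?\<psi> = "\<lambda>y. - Dx c x0 y"
  let ?A = "dd (\<xi>, 0) (dd (\<xi>, 0) C)" and ?B = "dd (\<zeta>, 0) C"
  have x0: "x0 \<in> closure U" and y: "y \<in> closure V" using xU yV closure_subset by auto
  define p0 where "p0 = ?\<psi> yt"
  define b where "b = ?\<psi> y - ?\<psi> yt"
  have inj: "inj_on ?\<psi> (closure V)" using diffeo_y[OF x0] by (simp add: diffeo_onto_range_def)
  have cl: "?\<psi> ` closure V = closure (?\<psi> ` V)" and op: "open (?\<psi> ` V)"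
    by (rule diffeo_onto_range_closure[OF diffeo_y[OF x0] V])+
  have conv: "convex (?\<psi> ` V)" using B2 x0 by (simp add: B2_def)
  \<comment> \<open>A segment from a closure point to an interior point of a convex set is interior
    except possibly at its start. So a boundary point \<open>yt\<close> is allowed while the curve
    is in \<open>V\<close> for positive t.\<close>
  have seg_int: "p0 + t *\<^sub>R b \<in> ?\<psi> ` V" if "0 < t" "t \<le> 1" for t
  proof -
    have "p0 - t *\<^sub>R (p0 - ?\<psi> y) \<in> interior (?\<psi> ` V)"
      by (rule mem_interior_closure_convex_shrink[OF conv _ _ that])
         (use op yV yt cl in \<open>auto simp: p0_def interior_open\<close>)
    then show ?thesis using op by (simp add: interior_open b_def p0_def algebra_simps)
  qed
  have seg: "p0 + t *\<^sub>R b \<in> ?\<psi> ` closure V" if "t \<in> ?T" for t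
  proof (cases "t = 0")
    case True
    then show ?thesis using yt by (auto simp: p0_def)
  next
    case False
    then show ?thesis using seg_int[of t] that closure_subset[of V] by auto
  qed
  define Y where "Y t = inv_into (closure V) ?\<psi> (p0 + t *\<^sub>R b)" for t
  have Y0: "Y 0 = yt" and Y1: "Y 1 = y"
    using inv_into_f_f[OF inj yt] inv_into_f_f[OF inj y] by (simp_all add: Y_def p0_def b_def)
  have YV: "Y t \<in> V" if t: "0 < t" "t \<le> 1" for t
  proof -
    obtain v where v: "v \<in> V" "p0 + t *\<^sub>R b = ?\<psi> v" using seg_int[OF t] by auto
    then have "v \<in> closure V" using closure_subset by blast
    then show ?thesis using v inv_into_f_f[OF inj, of v] by (simp add: Y_def)
  qed
  have mem: "(x0, Y t) \<in> W" if "t \<in> ?T" for t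
    unfolding Y_def by (rule inW[OF x0 inv_into_into[OF seg[OF that]]])
  have T: "0 < (1::real)" by simp
  obtain \<eta> \<omega> where Y:
    "\<And>t. t \<in> ?T \<Longrightarrow> (Y has_vector_derivative \<eta> t) (at t within ?T)"
    "\<And>t. t \<in> ?T \<Longrightarrow> (\<eta> has_vector_derivative \<omega> t) (at t within ?T)"
    "\<And>t e. t \<in> ?T \<Longrightarrow> dd (0, \<eta> t) (dd (e, 0) C) (x0, Y t) = - (b \<bullet> e)"
    "\<And>t e. t \<in> ?T \<Longrightarrow> dd (0, \<eta> t) (dd (0, \<eta> t) (dd (e, 0) C)) (x0, Y t) + dd (0, \<omega> t) (dd (e, 0) C) (x0, Y t) = 0"
    by (rule y_segment[OF x0 T seg, unfolded Y_def[symmetric]], assumption) (rule that; assumption)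
  have yp: "((\<lambda>t. (x0, Y t)) has_vector_derivative (0, \<eta> t)) (at t within ?T)"
      "((\<lambda>t. (0::'a, \<eta> t)) has_vector_derivative (0, \<omega> t)) (at t within ?T)" if "t \<in> ?T" for t
    by (intro has_vector_derivative_Pair Y that has_vector_derivative_const)+
  have "- (?A (x0, Y 0) + ?B (x0, Y 0)) \<le> - (?A (x0, Y 1) + ?B (x0, Y 1))"
  proof (rule le_endpoint_if_second_derivative_nonneg)
    fix t assume t: "t \<in> ?T"
    show "((\<lambda>t. - (?A (x0, Y t) + ?B (x0, Y t))) has_real_derivative
        - (dd (0, \<eta> t) ?A (x0, Y t) + dd (0, \<eta> t) ?B (x0, Y t))) (at t within ?T)"
      by (intro DERIV_minus DERIV_add has_real_derivative_curve C_diff mem t yp)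
    show "((\<lambda>t. - (dd (0, \<eta> t) ?A (x0, Y t) + dd (0, \<eta> t) ?B (x0, Y t))) has_real_derivative
        - ((dd (0, \<eta> t) (dd (0, \<eta> t) ?A) (x0, Y t) + dd (0, \<omega> t) ?A (x0, Y t))
         + (dd (0, \<eta> t) (dd (0, \<eta> t) ?B) (x0, Y t) + dd (0, \<omega> t) ?B (x0, Y t)))) (at t within ?T)"
      by (intro DERIV_minus DERIV_add
          has_real_derivative_curve2[OF C_smooth(5) W(1) mem t yp(1)[OF t] yp(2)[OF t]]
          has_real_derivative_curve2[OF C_smooth(4) W(1) mem t yp(1)[OF t] yp(2)[OF t]])
  next
    fix t :: real assume t01: "0 < t" "t < 1"
    then have t: "t \<in> ?T" by simp
    have "A3w U V c \<and> dd (\<xi>, 0) (dd (0, \<eta> t) C) (x0, Y t) = 0 \<or> B3 U V c"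
      using curv
    proof (elim disjE conjE)
      assume A: "A3w U V c" "dd (\<xi>, 0) C (x0, y) = dd (\<xi>, 0) C (x0, yt)"
      \<comment> \<open>The y-segment has constant velocity \<open>b\<close> in its coordinates, so
        the mixed derivative along \<open>\<xi>\<close> is \<open>- (b \<bullet> \<xi>)\<close> for
        every t. A single criticality condition thus provides the orthogonality demanded by
        \<open>A3w\<close> along the entire curve.\<close>
      have "b \<bullet> \<xi> = 0"
        using A(2) Dx_inner[OF inW[OF x0 y], of \<xi>] Dx_inner[OF inW[OF x0 yt], of \<xi>]
        by (simp add: b_def inner_diff_left)
      then have "dd (\<xi>, 0) (dd (0, \<eta> t) C) (x0, Y t) = 0"
        using Y(3)[OF t, of \<xi>] dd_commute[OF C_smooth(1) W(1) mem[OF t], of "(\<xi>, 0)" "(0, \<eta> t)"] by simp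
      with A(1) show ?thesis by simp
    qed simp
    \<comment> \<open>The terms with \<open>?B\<close> account for the acceleration of the x-segment
      for \<open>yt\<close>. They cancel, being the second-order equation of the y-segment tested
      against \<open>\<zeta>\<close>.\<close>
    from cross_derivative_nonpos[OF xU YV[OF t01(1) less_imp_le[OF t01(2)]] Y(4)[OF t] this]
    show "0 \<le> - ((dd (0, \<eta> t) (dd (0, \<eta> t) ?A) (x0, Y t) + dd (0, \<omega> t) ?A (x0, Y t))
         + (dd (0, \<eta> t) (dd (0, \<eta> t) ?B) (x0, Y t) + dd (0, \<omega> t) ?B (x0, Y t)))"
      using Y(4)[OF t, of \<zeta>] by linarith
  next
    have W0: "(x0, yt) \<in> W" by (rule inW[OF x0 yt])
    have "dd (0, \<eta> 0) ?A (x0, yt) = dd (\<xi>, 0) (dd (\<xi>, 0) (dd (0, \<eta> 0) C)) (x0, yt)"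
      by (rule dd_rotate3[OF C_smooth(2) W(1) W0, symmetric])
    moreover have "dd (0, \<eta> 0) ?B (x0, yt) = dd (\<zeta>, 0) (dd (0, \<eta> 0) C) (x0, yt)"
      by (rule dd_commute[OF C_smooth(1) W(1) W0])
    ultimately show "0 \<le> - (dd (0, \<eta> 0) ?A (x0, Y 0) + dd (0, \<eta> 0) ?B (x0, Y 0))"
      using zeta[of "\<eta> 0"] unfolding Y0 by linarith
  qed
  then show ?thesis unfolding Y0 Y1 by linarith
qed


text \<open>End points in the image of the open \<open>U\<close> and \<open>y\<close> in the open
  \<open>V\<close> leave room for the two-sided test curves and for moving \<open>y\<close>; only
  \<open>yt\<close> may lie on the boundary.\<close>

lemma level_along_segment:
  assumes yt: "yt \<in> closure V" and y: "y \<in> V"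
    and q0: "q0 \<in> (\<lambda>x. - Dy c x yt) ` U" and q1: "q1 \<in> (\<lambda>x. - Dy c x yt) ` U"
  defines "X \<equiv> \<lambda>t. inv_into (closure U) (\<lambda>x. - Dy c x yt) (q0 + t *\<^sub>R (q1 - q0))"
  defines "f \<equiv> \<lambda>t. c (X t) yt - c (X t) y"
  shows "A3w U V c \<Longrightarrow> t \<in> {0..1} \<Longrightarrow> f t \<le> max (f 0) (f 1)"
    and "B3 U V c \<Longrightarrow> t \<in> {0..1} \<Longrightarrow> f t \<le> (1 - t) * f 0 + t * f 1"
proof -
  let ?T = "{0..1::real}" and ?\<phi> = "\<lambda>x. - Dy c x yt"
  define b where "b = q1 - q0"
  have inj: "inj_on ?\<phi> (closure U)" using diffeo_x[OF yt] by (simp add: diffeo_onto_range_def)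
  have conv: "convex (?\<phi> ` U)" using B2 yt by (simp add: B2_def)
  have segU: "q0 + t *\<^sub>R b \<in> ?\<phi> ` U" if "t \<in> ?T" for t
  proof -
    have "(1 - t) *\<^sub>R q0 + t *\<^sub>R q1 \<in> ?\<phi> ` U"
      using that by (intro convexD_alt[OF conv q0 q1]) auto
    then show ?thesis by (simp add: b_def algebra_simps)
  qed
  then have seg: "q0 + t *\<^sub>R b \<in> ?\<phi> ` closure U" if "t \<in> ?T" for t
    using that closure_subset[of U] by blast
  have X_def': "X t = inv_into (closure U) ?\<phi> (q0 + t *\<^sub>R b)" for t
    by (simp add: X_def b_def)
  have XU: "X t \<in> U" if t: "t \<in> ?T" for t
  proof -
    obtain v where v: "v \<in> U" "q0 + t *\<^sub>R b = ?\<phi> v" using segU[OF t] by auto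
    then have "v \<in> closure U" using closure_subset by blast
    then show ?thesis using v inv_into_f_f[OF inj, of v] by (simp add: X_def')
  qed
  have Xc: "X t \<in> closure U" if "t \<in> ?T" for t using XU[OF that] closure_subset by auto
  have mem: "(X t, v) \<in> W" if "t \<in> ?T" "v \<in> closure V" for t v by (rule inW[OF Xc[OF that(1)] that(2)])
  have memV: "(X t, v) \<in> W" if "t \<in> ?T" "v \<in> V" for t v
    using mem that closure_subset by blast
  have T: "0 < (1::real)" by simp
  obtain x1 x2 where X:
    "\<And>t. t \<in> ?T \<Longrightarrow> (X has_vector_derivative x1 t) (at t within ?T)"
    "\<And>t. t \<in> ?T \<Longrightarrow> (x1 has_vector_derivative x2 t) (at t within ?T)"
    "continuous_on ?T x2"
    "\<And>t e. t \<in> ?T \<Longrightarrow> dd (x1 t, 0) (dd (0, e) C) (X t, yt) = - (b \<bullet> e)"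
    "\<And>t e. t \<in> ?T \<Longrightarrow> dd (x1 t, 0) (dd (x1 t, 0) (dd (0, e) C)) (X t, yt) + dd (x2 t, 0) (dd (0, e) C) (X t, yt) = 0"
    by (rule x_segment[OF yt T seg, unfolded X_def'[symmetric]], assumption) (rule that; assumption)
  have cX: "continuous_on ?T X" and cx1: "continuous_on ?T x1"
    using X(1,2) has_vector_derivative_continuous continuous_on_eq_continuous_within by blast+
  define G where "G t v = dd (x1 t, 0) (dd (x1 t, 0) C) (X t, v) + dd (x2 t, 0) C (X t, v)" for t v
  define f1 where "f1 t = dd (x1 t, 0) C (X t, yt) - dd (x1 t, 0) C (X t, y)" for t
  define f2 where "f2 t = G t yt - G t y" for t
  have xp: "((\<lambda>t. (X t, v)) has_vector_derivative (x1 t, 0)) (at t within ?T)"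
      "((\<lambda>t. (x1 t, 0::'a)) has_vector_derivative (x2 t, 0)) (at t within ?T)" if "t \<in> ?T" for t v
    by (intro has_vector_derivative_Pair X that has_vector_derivative_const)+
  have der: "((\<lambda>t. C (X t, v)) has_real_derivative dd (x1 t, 0) C (X t, v)) (at t within ?T)"
     "((\<lambda>t. dd (x1 t, 0) C (X t, v)) has_real_derivative G t v) (at t within ?T)"
    if "t \<in> ?T" "v \<in> closure V" for t v
  proof -
    show "((\<lambda>t. C (X t, v)) has_real_derivative dd (x1 t, 0) C (X t, v)) (at t within ?T)"
      by (intro has_real_derivative_curve C_diff mem that xp)
    show "((\<lambda>t. dd (x1 t, 0) C (X t, v)) has_real_derivative G t v) (at t within ?T)"
      unfolding G_def by (intro has_real_derivative_curve2[OF C_smooth(1) W(1)] mem that xp)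
  qed
  have yc: "y \<in> closure V" using y closure_subset by auto
  have df: "(f has_real_derivative f1 t) (at t within ?T)" if "t \<in> ?T" for t
    using DERIV_diff[OF der(1)[OF that yt] der(1)[OF that yc]] by (simp add: f_def f1_def)
  have df1: "(f1 has_real_derivative f2 t) (at t within ?T)" if "t \<in> ?T" for t
    using DERIV_diff[OF der(2)[OF that yt] der(2)[OF that yc]] by (simp add: f1_def[abs_def] f2_def)
  have G_le: "G t v \<le> G t yt"
    if "t \<in> ?T" "v \<in> V" "A3w U V c \<and> dd (x1 t, 0) C (X t, v) = dd (x1 t, 0) C (X t, yt) \<or> B3 U V c" for t v
    unfolding G_def by (rule second_derivative_nonneg[OF XU[OF that(1)] that(2) yt X(5)[OF that(1)] that(3)])
  have at: "at t within ?T = at t" if "0 < t" "t < 1" for t :: real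
    using that by (simp add: at_within_Icc_at)
  \<comment> \<open>Subtracting the chord reduces convexity to quasiconvexity with \<open>L = 0\<close>.\<close>
  show "f t \<le> (1 - t) * f 0 + t * f 1" if B3: "B3 U V c" and t: "t \<in> ?T"
  proof -
    define g where "g t = f t - ((1 - t) * f 0 + t * f 1)" for t
    have dg: "(g has_real_derivative f1 t - (f 1 - f 0)) (at t within ?T)" if "t \<in> ?T" for t
      unfolding g_def by (auto intro!: derivative_eq_intros df[OF that])
    have dg1: "((\<lambda>t. f1 t - (f 1 - f 0)) has_real_derivative f2 t) (at t within ?T)" if "t \<in> ?T" for t
      by (auto intro!: derivative_eq_intros df1[OF that])
    have f2: "f2 t \<ge> 0" if "t \<in> ?T" for t
      using G_le[OF that y] B3 by (simp add: f2_def)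
    have "g t \<le> max (g 0) (g 1)"
    proof (rule quasiconvex_if_second_derivative_bound[OF dg dg1 _ t])
      show "\<exists>\<delta>>0. \<exists>L. \<forall>s\<in>{0<..<1}. \<bar>s - t\<bar> < \<delta> \<longrightarrow> 0 < f1 s - (f 1 - f 0) \<longrightarrow>
          - L * (f1 s - (f 1 - f 0)) \<le> f2 s" for t
        by (intro exI[of _ 1] conjI exI[of _ 0]) (auto intro!: f2)
    qed
    then show ?thesis by (simp add: g_def)
  qed
  show "f t \<le> max (f 0) (f 1)" if A3w: "A3w U V c" and t: "t \<in> ?T"
  \<comment> \<open>A degenerate segment makes \<open>f\<close> constant. Otherwise the velocity is
    nonzero, which the choice of the perturbation direction requires.\<close>
  proof (cases "b = 0")
    case True
    then show ?thesis by (simp add: f_def X_def')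
  next
    case False
    show ?thesis
    proof (rule quasiconvex_if_second_derivative_bound[OF df df1 _ t])
      fix r :: real assume r: "0 < r" "r < 1" "f1 r = 0"
      have rT: "r \<in> ?T" using r by simp
      define \<xi> where "\<xi> = x1 r"
      have "\<xi> \<noteq> 0"
      proof
        assume "\<xi> = 0"
        then have "b \<bullet> b = 0"
          using X(4)[OF rT, of b] linear_0[OF dd_linear[OF C_diff(2)[OF mem[OF rT yt]]], of "(0, b)"]
          by (simp add: \<xi>_def flip: zero_prod_def)
        with False show False by simp
      qed
      obtain A where A: "bij A" "\<And>v e. dd (0, v) (dd (e, 0) C) (X r, y) = A v \<bullet> e"
        using mixed_bij_y[OF Xc[OF rT] yc] by metis
      \<comment> \<open>Moving \<open>y\<close> by \<open>\<tau> *\<^sub>R e\<close> changes \<open>f1 r\<close> by \<open>- \<tau>\<close> to first order.\<close>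
      obtain e where e: "A e = (1 / (\<xi> \<bullet> \<xi>)) *\<^sub>R \<xi>"
        using bij_is_surj[OF A(1)] by (metis surjD)
      have e1: "dd (0, e) (dd (x1 r, 0) C) (X r, y) = 1"
        unfolding \<xi>_def[symmetric] A(2) e using \<open>\<xi> \<noteq> 0\<close> by simp
      obtain \<rho> where \<rho>: "\<rho> > 0" "\<And>\<tau>. \<bar>\<tau>\<bar> \<le> \<rho> \<Longrightarrow> y + \<tau> *\<^sub>R e \<in> V"
      proof -
        obtain \<epsilon> where \<epsilon>: "\<epsilon> > 0" "\<And>s t. 0 \<le> s \<Longrightarrow> s \<le> \<epsilon> \<Longrightarrow> t \<in> {-1..1} \<Longrightarrow> y + t *\<^sub>R (s *\<^sub>R e) \<in> V"
          by (rule small_segment[OF V(1) y]) blast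
        have "y + \<tau> *\<^sub>R e \<in> V" if "\<bar>\<tau>\<bar> \<le> \<epsilon>" for \<tau>
          using \<epsilon>(2)[of "\<bar>\<tau>\<bar>" "sgn \<tau>"] that by (simp add: sgn_mult_abs) (simp add: sgn_if)
        then show thesis using that \<open>\<epsilon> > 0\<close> by blast
      qed
      \<comment> \<open>Compact set of pairs (time, displacement of \<open>y\<close>). On it
        \<open>- P\<close> is the rate at which a displacement changes \<open>f1\<close>, and
        \<open>Q\<close> the rate at which it changes the second x-derivative \<open>G\<close>; both
        are continuous, so the estimates are uniform in time.\<close>
      define D where "D = ?T \<times> {- \<rho>..\<rho>}"
      define P where "P z = dd (0, e) (dd (x1 (fst z), 0) C) (X (fst z), y + snd z *\<^sub>R e)" for z
      define Q where "Q z = dd (x1 (fst z), 0) (dd (x1 (fst z), 0) (dd (0, e) C)) (X (fst z), y + snd z *\<^sub>R e)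
          + dd (x2 (fst z), 0) (dd (0, e) C) (X (fst z), y + snd z *\<^sub>R e)" for z
      have yV: "y + \<tau> *\<^sub>R e \<in> V" if "\<tau> \<in> {-\<rho>..\<rho>}" for \<tau>
        using \<rho>(2)[of \<tau>] that by auto
      have memD: "(\<lambda>z. (X (fst z), y + snd z *\<^sub>R e)) ` D \<subseteq> W"
        using memV yV by (auto simp: D_def)
      have cD: "continuous_on D (\<lambda>z. g (fst z))" if "continuous_on ?T g" for g :: "real \<Rightarrow> 'a"
        by (rule continuous_on_compose2[OF that continuous_on_fst[OF continuous_on_id]]) (auto simp: D_def)
      note cont = continuous_on_Pair continuous_on_const cD[OF cX] cD[OF cx1] cD[OF X(3)]
        continuous_on_add continuous_on_scaleR continuous_on_snd continuous_on_id
      have cP: "continuous_on D P"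
        unfolding P_def by (intro continuous_on_dd2[OF C_smooth(1) W(1)] cont memD)
      have cQ: "continuous_on D Q"
        unfolding Q_def
        by (intro continuous_on_add continuous_on_dd2[OF C_smooth(4) W(1)]
            continuous_on_dd[OF Ck_mono[OF C_smooth(4)]] cont memD) simp
      have "compact (Q ` D)"
        by (rule compact_continuous_image[OF cQ]) (auto simp: D_def intro: compact_Times)
      then obtain L where L: "\<And>z. z \<in> D \<Longrightarrow> \<bar>Q z\<bar> \<le> L"
        using compact_imp_bounded bounded_iff by (metis image_eqI real_norm_def)
      have rD: "(r, 0) \<in> D" using rT \<rho>(1) by (simp add: D_def)
      have L0: "L \<ge> 0" using L[OF rD] by linarith
      \<comment> \<open>By continuity the rate stays above 1/2 nearby, so a displacement of at most
        \<open>2 * f1 s\<close> suffices to cancel \<open>f1 s\<close>.\<close>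
      have "P (r, 0) = 1" by (simp add: P_def e1)
      moreover have "\<exists>\<delta>>0. \<forall>z\<in>D. dist z (r, 0) < \<delta> \<longrightarrow> dist (P z) (P (r, 0)) < 1/2"
        using cP[unfolded continuous_on_iff, rule_format, OF rD, of "1/2"] by simp
      ultimately obtain \<delta> where \<delta>: "\<delta> > 0" "\<And>z. z \<in> D \<Longrightarrow> dist z (r, 0) < \<delta> \<Longrightarrow> P z > 1/2"
        by (force simp: dist_real_def abs_if split: if_splits)
      \<comment> \<open>Bounds the displacements \<open>\<tau> \<le> 2 * f1 s\<close>: being below
        \<open>\<delta> / 2\<close> they stay where \<open>P\<close> exceeds 1/2, being below
        \<open>\<rho>\<close> they keep the moved point in \<open>V\<close>. Since
        \<open>f1 r = 0\<close>, closeness of s to \<open>r\<close> enforces the bound.\<close>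
      define \<mu> where "\<mu> = min (\<delta> / 2) \<rho>"
      have \<mu>: "\<mu> > 0" "\<mu> \<le> \<delta> / 2" "\<mu> \<le> \<rho>" using \<delta> \<rho> by (auto simp: \<mu>_def)
      have "continuous_on ?T f1" using df1 DERIV_continuous_on by blast
      then obtain \<kappa> where \<kappa>: "\<kappa> > 0" "\<And>s. s \<in> ?T \<Longrightarrow> dist s r < \<kappa> \<Longrightarrow> dist (f1 s) (f1 r) < \<mu> / 2"
        using \<mu>(1) rT unfolding continuous_on_iff by (metis half_gt_zero)
      have "f2 s \<ge> - (2 * L) * f1 s" if s: "s \<in> {0<..<1}" "\<bar>s - r\<bar> < min \<kappa> (\<delta> / 2)" "f1 s > 0" for s
      proof -
        have sT: "s \<in> ?T" using s by auto
        have small: "2 * f1 s < \<mu>" using \<kappa>(2)[OF sT] s r(3) by (simp add: dist_real_def)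
        have D: "(s, \<tau>) \<in> D" and Pge: "P (s, \<tau>) > 1/2" and vV: "y + \<tau> *\<^sub>R e \<in> V"
          if "0 \<le> \<tau>" "\<tau> \<le> 2 * f1 s" for \<tau>
        proof -
          show "(s, \<tau>) \<in> D" using that small \<mu> sT by (auto simp: D_def)
          moreover have "dist (s, \<tau>) (r, 0) < \<delta>"
          proof -
            have "dist (s, \<tau>) (r, 0) \<le> \<bar>s - r\<bar> + \<bar>\<tau>\<bar>"
              using sqrt_sum_squares_le_sum_abs[of "s - r" \<tau>] by (simp add: dist_Pair_Pair dist_real_def)
            also have "\<dots> < \<delta>" using s(2) that small \<mu> by auto
            finally show ?thesis .
          qed
          ultimately show "P (s, \<tau>) > 1/2" by (rule \<delta>(2))
          show "y + \<tau> *\<^sub>R e \<in> V" using that small \<mu> by (intro yV) auto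
        qed
        \<comment> \<open>\<open>\<theta> \<tau>\<close> is \<open>f1 s\<close> with
          \<open>y\<close> moved by \<open>\<tau> *\<^sub>R e\<close>; a zero of
          \<open>\<theta>\<close> is a displacement for which s is critical.\<close>
        define \<theta> where "\<theta> \<tau> = dd (x1 s, 0) C (X s, yt) - dd (x1 s, 0) C (X s, y + \<tau> *\<^sub>R e)" for \<tau>
        define K where "K \<tau> = G s (y + \<tau> *\<^sub>R e)" for \<tau>
        have line: "((\<lambda>\<tau>. (X s, y + \<tau> *\<^sub>R e)) has_vector_derivative (0, e)) (at \<tau>)" for \<tau>
          by (intro has_vector_derivative_Pair) (auto intro!: derivative_eq_intros)
        have d\<theta>: "DERIV \<theta> \<tau> :> - P (s, \<tau>)" if "0 \<le> \<tau>" "\<tau> \<le> 2 * f1 s" for \<tau>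
        proof -
          have "DERIV (\<lambda>\<tau>. dd (x1 s, 0) C (X s, y + \<tau> *\<^sub>R e)) \<tau> :> P (s, \<tau>)"
            unfolding P_def fst_conv snd_conv
            by (intro has_real_derivative_curve[OF _ line] C_diff memV sT vV that)
          from DERIV_diff[OF DERIV_const this] show ?thesis by (simp add: \<theta>_def[abs_def])
        qed
        have dK: "DERIV K \<tau> :> Q (s, \<tau>)" if "0 \<le> \<tau>" "\<tau> \<le> 2 * f1 s" for \<tau>
        proof -
          have m: "(X s, y + \<tau> *\<^sub>R e) \<in> W" by (intro memV sT vV that)
          have "DERIV K \<tau> :> dd (0, e) (dd (x1 s, 0) (dd (x1 s, 0) C)) (X s, y + \<tau> *\<^sub>R e)
              + dd (0, e) (dd (x2 s, 0) C) (X s, y + \<tau> *\<^sub>R e)"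
            unfolding K_def G_def by (intro DERIV_add has_real_derivative_curve[OF _ line] C_diff m)
          also have "dd (0, e) (dd (x1 s, 0) (dd (x1 s, 0) C)) (X s, y + \<tau> *\<^sub>R e)
              + dd (0, e) (dd (x2 s, 0) C) (X s, y + \<tau> *\<^sub>R e) = Q (s, \<tau>)"
            unfolding Q_def fst_conv snd_conv dd_rotate3[OF C_smooth(2) W(1) m, of "(x1 s, 0)" "(x1 s, 0)" "(0, e)"]
              dd_commute[OF C_smooth(1) W(1) m, of "(0, e)" "(x2 s, 0)"] ..
          finally show ?thesis .
        qed
        have pos: "0 < 2 * f1 s" using s(3) by simp
        obtain z where z: "0 < z" "z < 2 * f1 s" "\<theta> (2 * f1 s) - \<theta> 0 = (2 * f1 s - 0) * - P (s, z)"
          using MVT2[OF pos d\<theta>] by blast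
        \<comment> \<open>With slope below -1/2, \<open>\<theta>\<close> loses at least its initial
          value \<open>f1 s\<close> over an interval of length \<open>2 * f1 s\<close>.\<close>
        have "2 * f1 s * P (s, z) \<ge> 2 * f1 s * (1/2)"
          using Pge[of z] z s(3) by (intro mult_left_mono) auto
        then have "\<theta> (2 * f1 s) \<le> 0"
          using z(3) by (simp add: \<theta>_def f1_def)
        moreover have "\<theta> 0 \<ge> 0" using s(3) by (simp add: \<theta>_def f1_def)
        ultimately have "\<exists>\<tau>\<ge>0. \<tau> \<le> 2 * f1 s \<and> \<theta> \<tau> = 0"
          using pos d\<theta> DERIV_isCont by (intro IVT2) (auto intro: DERIV_isCont)
        then obtain \<tau> where \<tau>: "0 \<le> \<tau>" "\<tau> \<le> 2 * f1 s" "\<theta> \<tau> = 0" by blast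
        \<comment> \<open>Criticality for the moved point makes \<open>A3w\<close> applicable.
          Moving back to \<open>y\<close> costs at most \<open>L * \<tau>\<close>, whence the
          constant \<open>2 * L\<close>.\<close>
        have "K \<tau> \<le> G s yt"
          unfolding K_def using A3w \<tau>(3) by (intro G_le[OF sT vV[OF \<tau>(1,2)]]) (simp add: \<theta>_def)
        moreover have "K \<tau> - K 0 \<ge> - (L * \<tau>)"
        proof (cases "\<tau> = 0")
          case False
          then have "0 < \<tau>" using \<tau> by simp
          obtain w where w: "0 < w" "w < \<tau>" "K \<tau> - K 0 = (\<tau> - 0) * Q (s, w)"
            using MVT2[OF \<open>0 < \<tau>\<close>, of K "\<lambda>\<tau>. Q (s, \<tau>)"] dK \<tau> by (metis order_trans)
          have "\<tau> * Q (s, w) \<ge> \<tau> * - L"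
            using L[OF D[of w]] w \<tau> by (intro mult_left_mono) auto
          then show ?thesis using w(3) by (simp add: mult.commute)
        qed simp
        moreover have "L * \<tau> \<le> L * (2 * f1 s)" using \<tau> L0 by (intro mult_left_mono)
        ultimately show ?thesis by (simp add: f2_def K_def)
      qed
      moreover have "min \<kappa> (\<delta> / 2) > 0" using \<kappa> \<delta> by simp
      ultimately show "\<exists>\<delta>>0. \<exists>L. \<forall>s\<in>{0<..<1}. \<bar>s - r\<bar> < \<delta> \<longrightarrow> f1 s > 0 \<longrightarrow> f2 s \<ge> - L * f1 s"
        by blast
    qed
  qed
qed


section \<open>Passage to the closed domains by approximation\<close>

lemma cexp_dom_facts:
  assumes "yt \<in> closure V"
  shows "convex (cexp_dom U c yt)" "cexp_x U c yt ` cexp_dom U c yt = closure U"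
    "continuous_on (cexp_dom U c yt) (cexp_x U c yt)" "cexp_dom U c yt = closure ((\<lambda>x. - Dy c x yt) ` U)"
proof -
  note d = diffeo_onto_range_closure[OF diffeo_x[OF assms] U]
  show eq: "cexp_dom U c yt = closure ((\<lambda>x. - Dy c x yt) ` U)"
    using d(3) by (simp add: cexp_dom_def)
  show "convex (cexp_dom U c yt)"
    unfolding eq using B2 assms by (intro convex_closure) (simp add: B2_def)
  show "continuous_on (cexp_dom U c yt) (cexp_x U c yt)"
    using d(4) by (simp add: cexp_dom_def cexp_x_def)
  show "cexp_x U c yt ` cexp_dom U c yt = closure U"
    unfolding cexp_dom_def cexp_x_def
    by (rule inv_into_image_cancel) (use diffeo_x[OF assms] in \<open>auto simp: diffeo_onto_range_def\<close>)
qed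

lemma level_tendsto:
  assumes yt: "yt \<in> closure V" and q: "\<And>n. q n \<in> cexp_dom U c yt" "q \<longlonglongrightarrow> p" "p \<in> cexp_dom U c yt"
    and y: "\<And>n. y n \<in> closure V" "y \<longlonglongrightarrow> z" "z \<in> closure V"
  shows "(\<lambda>n. c (cexp_x U c yt (q n)) (y n)) \<longlonglongrightarrow> c (cexp_x U c yt p) z"
proof -
  note X = cexp_dom_facts(2,3)[OF yt]
  have Xm: "cexp_x U c yt r \<in> closure U" if "r \<in> cexp_dom U c yt" for r
    using imageI[OF that, of "cexp_x U c yt"] X(1) by simp
  have "(\<lambda>n. cexp_x U c yt (q n)) \<longlonglongrightarrow> cexp_x U c yt p"
    by (rule continuous_on_tendsto_compose[OF X(2) q(2,3)]) (simp add: q(1))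
  from tendsto_Pair[OF this y(2)]
  have "(\<lambda>n. C (cexp_x U c yt (q n), y n)) \<longlonglongrightarrow> C (cexp_x U c yt p, z)"
    by (rule continuous_on_tendsto_compose[OF Ck_continuous_on[OF C4]])
       (simp_all add: inW Xm q y)
  then show ?thesis by simp
qed

text \<open>Both end points and \<open>y\<close> are approximated simultaneously from the open sets,
  and the nonstrict inequalities survive the limit. \<open>yt\<close> is kept fixed, since it
  determines the coordinates.\<close>

lemma level_along_closed_segment:
  fixes q0 q1 y yt :: 'a and t :: real
  assumes yt: "yt \<in> closure V" and y: "y \<in> closure V" and t: "t \<in> {0..1}"
    and q: "q0 \<in> cexp_dom U c yt" "q1 \<in> cexp_dom U c yt"
  defines "f \<equiv> \<lambda>q. c (cexp_x U c yt q) yt - c (cexp_x U c yt q) y"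
  shows "A3w U V c \<Longrightarrow> f ((1 - t) *\<^sub>R q0 + t *\<^sub>R q1) \<le> max (f q0) (f q1)"
    and "B3 U V c \<Longrightarrow> f ((1 - t) *\<^sub>R q0 + t *\<^sub>R q1) \<le> (1 - t) * f q0 + t * f q1"
proof -
  let ?S = "(\<lambda>x. - Dy c x yt) ` U" and ?D = "cexp_dom U c yt"
  note dom = cexp_dom_facts[OF yt]
  obtain a where a: "\<And>n. a n \<in> ?S" "a \<longlonglongrightarrow> q0" using q(1) unfolding dom(4) closure_sequential by blast
  obtain b where b: "\<And>n. b n \<in> ?S" "b \<longlonglongrightarrow> q1" using q(2) unfolding dom(4) closure_sequential by blast
  obtain w where w: "\<And>n. w n \<in> V" "w \<longlonglongrightarrow> y" using y unfolding closure_sequential by blast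
  have sub: "?S \<subseteq> ?D" unfolding dom(4) by (rule closure_subset)
  have aD: "a n \<in> ?D" and bD: "b n \<in> ?D" and wV: "w n \<in> closure V" for n
    using subsetD[OF sub a(1)] subsetD[OF sub b(1)] subsetD[OF closure_subset w(1)] .
  define m where "m n = (1 - t) *\<^sub>R a n + t *\<^sub>R b n" for n
  define p where "p = (1 - t) *\<^sub>R q0 + t *\<^sub>R q1"
  have mD: "m n \<in> ?D" and pD: "p \<in> ?D" for n
    unfolding m_def p_def using t aD bD q by (auto intro!: convexD_alt[OF dom(1)])
  have mp: "m \<longlonglongrightarrow> p" unfolding m_def p_def by (intro tendsto_intros a b)
  define F where "F n q = c (cexp_x U c yt q) yt - c (cexp_x U c yt q) (w n)" for n q
  have lim: "(\<lambda>n. F n (r n)) \<longlonglongrightarrow> f s" if "\<And>n. r n \<in> ?D" "r \<longlonglongrightarrow> s" "s \<in> ?D" for r s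
    unfolding F_def f_def
    by (rule tendsto_diff[OF level_tendsto[OF yt that yt tendsto_const yt] level_tendsto[OF yt that wV w(2) y]])
  have meq: "m n = a n + t *\<^sub>R (b n - a n)" for n by (simp add: m_def algebra_simps)
  note seg = level_along_segment[OF yt w(1) a(1) b(1), folded cexp_x_def]
  show "f ((1 - t) *\<^sub>R q0 + t *\<^sub>R q1) \<le> max (f q0) (f q1)" if "A3w U V c"
  proof (rule LIMSEQ_le)
    show "(\<lambda>n. F n (m n)) \<longlonglongrightarrow> f ((1 - t) *\<^sub>R q0 + t *\<^sub>R q1)"
      using lim[OF mD mp pD] by (simp add: p_def)
    show "(\<lambda>n. max (F n (a n)) (F n (b n))) \<longlonglongrightarrow> max (f q0) (f q1)"
      by (intro tendsto_max lim aD bD a b q)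
    show "\<exists>N. \<forall>n\<ge>N. F n (m n) \<le> max (F n (a n)) (F n (b n))"
      using seg(1)[OF that t] by (simp add: F_def meq)
  qed
  show "f ((1 - t) *\<^sub>R q0 + t *\<^sub>R q1) \<le> (1 - t) * f q0 + t * f q1" if "B3 U V c"
  proof (rule LIMSEQ_le)
    show "(\<lambda>n. F n (m n)) \<longlonglongrightarrow> f ((1 - t) *\<^sub>R q0 + t *\<^sub>R q1)"
      using lim[OF mD mp pD] by (simp add: p_def)
    show "(\<lambda>n. (1 - t) * F n (a n) + t * F n (b n)) \<longlonglongrightarrow> (1 - t) * f q0 + t * f q1"
      by (intro tendsto_intros lim aD bD a b q)
    show "\<exists>N. \<forall>n\<ge>N. F n (m n) \<le> (1 - t) * F n (a n) + t * F n (b n)"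
      using seg(2)[OF that t] by (simp add: F_def meq)
  qed
qed

end

section \<open>Suprema of cost functions\<close>

text \<open>Subtracting \<open>h\<close> from the cost and adding it to the function leaves the
  expression under the supremum unchanged, and \<open>X\<close> maps onto \<open>A\<close>, so the
  conjugate stays the same.\<close>

lemma kstar_pullback:
  assumes "X ` D = A"
  shows "kstar D (\<lambda>q y. k (X q) y - h (X q)) (\<lambda>q. u (X q) + h (X q)) y = kstar A k u y"
proof -
  have "- (k (X q) y - h (X q)) - (u (X q) + h (X q)) = - k (X q) y - u (X q)" for q by simp
  then show ?thesis unfolding kstar_def assms[symmetric] by (simp add: image_comp o_def)
qed

lemma ktrans_pullback:
  assumes "Y \<noteq> {}"
  shows "ktrans Y (\<lambda>q y. k (X q) y - h (X q)) v q = ktrans Y k v (X q) + ereal (h (X q))"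
proof -
  have "ereal (- (k (X q) y - h (X q))) - v y = ereal (- k (X q) y) - v y + ereal (h (X q))" for y
    by (cases "v y") auto
  then show ?thesis
    using SUP_ereal_add_left[OF assms, of "ereal (h (X q))" "\<lambda>y. ereal (- k (X q) y) - v y"]
    by (simp add: ktrans_def)
qed

lemma kconvex_pullback:
  assumes "X ` D = A" "Y \<noteq> {}" "kconvex A Y k u"
  shows "kconvex D Y (\<lambda>q y. k (X q) y - h (X q)) (\<lambda>q. u (X q) + h (X q))"
  unfolding kconvex_def
proof
  fix q assume "q \<in> D"
  then have "ereal (u (X q)) = ktrans Y k (kstar A k u) (X q)"
    using assms by (auto simp: kconvex_def)
  moreover have "kstar D (\<lambda>q y. k (X q) y - h (X q)) (\<lambda>q. u (X q) + h (X q)) = kstar A k u"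
    using kstar_pullback[OF assms(1)] by (intro ext)
  ultimately show "ereal (u (X q) + h (X q)) = ktrans Y (\<lambda>q y. k (X q) y - h (X q))
      (kstar D (\<lambda>q y. k (X q) y - h (X q)) (\<lambda>q. u (X q) + h (X q))) q"
    by (simp add: ktrans_pullback[OF assms(2)] flip: plus_ereal.simps(1))
qed

lemma ksubdiff_pullback:
  assumes "X ` D = A"
  shows "ksubdiff D Y (\<lambda>q y. k (X q) y - h (X q)) (\<lambda>q. u (X q) + h (X q)) q = ksubdiff A Y k u (X q)"
proof -
  have "ereal (u (X q) + h (X q)) + z + ereal (k (X q) y - h (X q)) = ereal (u (X q)) + z + ereal (k (X q) y)"
    for z y by (cases z) auto
  then show ?thesis by (simp add: ksubdiff_def kstar_pullback[OF assms])
qed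

text \<open>Together with \<open>kconvex_le\<close>, this expresses that \<open>w\<close> is the
  least upper bound of its supporting functions, which is how k-convexity is used from here
  on.\<close>

lemma kconvex_ge:
  assumes "kconvex D Y k w" "q \<in> D" "y \<in> Y"
  shows "ereal (- k q y) - kstar D k w y \<le> ereal (w q)"
  using assms by (auto simp: kconvex_def ktrans_def intro: SUP_upper)

lemma kconvex_le:
  assumes "kconvex D Y k w" "q \<in> D" "\<And>y. y \<in> Y \<Longrightarrow> ereal (- k q y) - kstar D k w y \<le> ereal l"
  shows "w q \<le> l"
proof -
  have "ereal (w q) = ktrans Y k (kstar D k w) q" using assms(1,2) by (simp add: kconvex_def)
  also have "\<dots> \<le> ereal l" unfolding ktrans_def by (rule SUP_least) (rule assms(3))
  finally show ?thesis by simp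
qed

text \<open>Quasiconvexity passes to suprema: for each \<open>y\<close> one of the two end points
  dominates, possibly a different one for different \<open>y\<close>, and both have value at most
  \<open>l\<close>.\<close>

lemma kconvex_sublevel_convex:
  assumes w: "kconvex D Y k w" and D: "convex D"
    and k: "\<And>q0 q1 t y. q0 \<in> D \<Longrightarrow> q1 \<in> D \<Longrightarrow> t \<in> {0..1} \<Longrightarrow> y \<in> Y \<Longrightarrow>
      - k ((1 - t) *\<^sub>R q0 + t *\<^sub>R q1) y \<le> max (- k q0 y) (- k q1 y)"
  shows "convex {q \<in> D. w q \<le> l}"
  unfolding convex_alt
proof (intro ballI allI impI)
  fix q0 q1 and t :: real
  assume q: "q0 \<in> {q \<in> D. w q \<le> l}" "q1 \<in> {q \<in> D. w q \<le> l}" and t: "0 \<le> t \<and> t \<le> 1"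
  let ?q = "(1 - t) *\<^sub>R q0 + t *\<^sub>R q1"
  have qD: "?q \<in> D" using convexD_alt[OF D] q t by blast
  have "w ?q \<le> l"
  proof (rule kconvex_le[OF w qD])
    fix y assume y: "y \<in> Y"
    obtain p where p: "p \<in> D" "w p \<le> l" "- k ?q y \<le> - k p y"
      using k[of q0 q1 t y] q t y by (auto simp: max_def split: if_splits)
    have "ereal (- k ?q y) - kstar D k w y \<le> ereal (- k p y) - kstar D k w y"
      using p(3) by (intro ereal_minus_mono) auto
    also have "\<dots> \<le> ereal (w p)" by (rule kconvex_ge[OF w p(1) y])
    also have "\<dots> \<le> ereal l" using p(2) by simp
    finally show "ereal (- k ?q y) - kstar D k w y \<le> ereal l" .
  qed
  then show "?q \<in> {q \<in> D. w q \<le> l}" using qD by simp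
qed

lemma kconvex_imp_convex_on:
  assumes w: "kconvex D Y k w" and D: "convex D"
    and k: "\<And>q0 q1 t y. q0 \<in> D \<Longrightarrow> q1 \<in> D \<Longrightarrow> t \<in> {0..1} \<Longrightarrow> y \<in> Y \<Longrightarrow>
      - k ((1 - t) *\<^sub>R q0 + t *\<^sub>R q1) y \<le> (1 - t) * - k q0 y + t * - k q1 y"
  shows "convex_on D w"
proof (rule convex_onI[OF _ D])
  fix t :: real and q0 q1
  assume t: "0 < t" "t < 1" and q: "q0 \<in> D" "q1 \<in> D"
  let ?q = "(1 - t) *\<^sub>R q0 + t *\<^sub>R q1"
  have qD: "?q \<in> D" using convexD_alt[OF D] q t by simp
  show "w ?q \<le> (1 - t) * w q0 + t * w q1"
  proof (rule kconvex_le[OF w qD])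
    fix y assume y: "y \<in> Y"
    show "ereal (- k ?q y) - kstar D k w y \<le> ereal ((1 - t) * w q0 + t * w q1)"
    \<comment> \<open>The conjugate may be infinite: the value \<infinity> contributes the trivial
      bound, and -\<infinity> is impossible because it would force the real number
      \<open>w q0\<close> to dominate \<infinity>.\<close>
    proof (cases "kstar D k w y")
      case (real r)
      have "- k q0 y - r \<le> w q0" "- k q1 y - r \<le> w q1"
        using kconvex_ge[OF w q(1) y] kconvex_ge[OF w q(2) y] real by simp_all
      then have "(1 - t) * (- k q0 y - r) + t * (- k q1 y - r) \<le> (1 - t) * w q0 + t * w q1"
        using t by (intro add_mono mult_left_mono) auto
      moreover have "- k ?q y \<le> (1 - t) * - k q0 y + t * - k q1 y" using k q t y by simp
      moreover have "(1 - t) * (- k q0 y - r) + t * (- k q1 y - r) = (1 - t) * - k q0 y + t * - k q1 y - r"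
        by (simp add: algebra_simps)
      ultimately show ?thesis using real by simp
    next
      case PInf
      then show ?thesis by simp
    next
      case MInf
      then show ?thesis using kconvex_ge[OF w q(1) y] by simp
    qed
  qed
qed

text \<open>Membership in the subdifferential says that \<open>a\<close> attains the supremum
  defining the conjugate at \<open>y\<close>, that is, minimizes \<open>u\<close> plus the cost to
  \<open>y\<close>.\<close>

lemma ksubdiff_minimum:
  assumes y: "y \<in> ksubdiff A Y k u a" and "b \<in> A"
  shows "u a + k a y \<le> u b + k b y"
proof -
  have eq: "ereal (u a) + kstar A k u y + ereal (k a y) = 0"
    using y by (simp add: ksubdiff_def)
  moreover have "ereal (- k b y - u b) \<le> kstar A k u y"
    unfolding kstar_def by (rule SUP_upper[OF assms(2)])
  ultimately show ?thesis by (cases "kstar A k u y") (auto simp: zero_ereal_def)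
qed

theorem theorem4p3:
  fixes U V :: "'a::euclidean_space set" and c :: "'a \<Rightarrow> 'a \<Rightarrow> real"
    and u :: "'a \<Rightarrow> real" and yt :: 'a
  assumes "open U" "bounded U" "open V" "bounded V"
    and "C4_on_closure c U V"
    and "B1 U V c" and "B2 U V c" and "A3w U V c"
    and "yt \<in> closure V"
    and "kconvex (closure U) (closure V) c u"
  shows "(\<forall>l. convex {q \<in> cexp_dom U c yt.
                 u (cexp_x U c yt q) + c (cexp_x U c yt q) yt \<le> l})
    \<and> (B3 U V c \<longrightarrow> convex_on (cexp_dom U c yt)
                 (\<lambda>q. u (cexp_x U c yt q) + c (cexp_x U c yt q) yt))
    \<and> (\<forall>q0\<in>cexp_dom U c yt.
          yt \<in> ksubdiff (closure U) (closure V) c u (cexp_x U c yt q0) \<longrightarrow>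
          (\<forall>q\<in>cexp_dom U c yt.
             u (cexp_x U c yt q0) + c (cexp_x U c yt q0) yt
               \<le> u (cexp_x U c yt q) + c (cexp_x U c yt q) yt))
    \<and> kconvex (cexp_dom U c yt) (closure V)
        (\<lambda>q y. c (cexp_x U c yt q) y - c (cexp_x U c yt q) yt)
        (\<lambda>q. u (cexp_x U c yt q) + c (cexp_x U c yt q) yt)
    \<and> (\<forall>q\<in>cexp_dom U c yt.
          ksubdiff (cexp_dom U c yt) (closure V)
            (\<lambda>q y. c (cexp_x U c yt q) y - c (cexp_x U c yt q) yt)
            (\<lambda>q. u (cexp_x U c yt q) + c (cexp_x U c yt q) yt) q
          = ksubdiff (closure U) (closure V) c u (cexp_x U c yt q))"
proof -
  let ?D = "cexp_dom U c yt" and ?X = "cexp_x U c yt" and ?Y = "closure V"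
  let ?k = "\<lambda>q y. c (?X q) y - c (?X q) yt" and ?w = "\<lambda>q. u (?X q) + c (?X q) yt"
  obtain W where "open W" "closure U \<times> closure V \<subseteq> W" "Ck 4 (\<lambda>z. c (fst z) (snd z)) W"
    using assms(5) by (auto simp: C4_on_closure_def)
  then interpret c_domain U V c W
    using assms by unfold_locales auto
  note dom = cexp_dom_facts[OF assms(9)]
  have Y: "?Y \<noteq> {}" using assms(9) by auto
  \<comment> \<open>The pullback with \<open>h x = c x yt\<close>. Convexity is then deduced for the
    modified cost, because \<open>- ?k q y\<close> is exactly the function controlled by
    \<open>level_along_closed_segment\<close>.\<close>
  have w: "kconvex ?D ?Y ?k ?w"
    by (rule kconvex_pullback[OF dom(2) Y assms(10)])
  have "convex {q \<in> ?D. ?w q \<le> l}" for l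
    by (rule kconvex_sublevel_convex[OF w dom(1)])
       (use level_along_closed_segment(1)[OF assms(9) _ _ _ _ assms(8)] in simp)
  moreover have "convex_on ?D ?w" if "B3 U V c"
    by (rule kconvex_imp_convex_on[OF w dom(1)])
       (use level_along_closed_segment(2)[OF assms(9) _ _ _ _ that] in simp)
  moreover have "?w q0 \<le> ?w q"
    if "yt \<in> ksubdiff (closure U) ?Y c u (?X q0)" "q \<in> ?D" for q0 q
    using ksubdiff_minimum[OF that(1)] dom(2) that(2) by blast
  moreover have "ksubdiff ?D ?Y ?k ?w q = ksubdiff (closure U) ?Y c u (?X q)" for q
    by (rule ksubdiff_pullback[OF dom(2)])
  ultimately show ?thesis
    using w by (intro conjI allI impI ballI)
qed

end
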